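(* Let $p$ be a prime with $p > 10^6$, and let $\Lambda_p$ be a $p$-core $p'$-partition of maximal size. Then \[\frac{1}{24}p^6 - p^5\sqrt{p} < |\Lambda_p| < \frac{1}{24}p^6 - \frac{1}{200}p^5\sqrt{p}.\]
   Context: For a partition $\lambda$, $|\lambda|$ denotes its size (the sum of its parts). A partition is called $p$-core if none of the hook lengths of its Young diagram is divisible by $p$, and is called a $p'$-partition if none of its parts is divisible by $p$. For each prime $p$ there are only finitely many $p$-core $p'$-partitions, so one of maximal size exists; for odd primes $p$ it is known to be unique, and it is denoted $\Lambda_p$. *)

theory Defs
  imports Complex_Main "HOL-Computational_Algebra.Primes"
begin

definition is_partition :: "nat list \<Rightarrow> bool" where
  "is_partition \<nu> \<longleftrightarrow> sorted_wrt (\<ge>) \<nu> \<and> 0 \<notin> set \<nu>"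

definition partition_size :: "nat list \<Rightarrow> nat" where
  "partition_size \<nu> = sum_list \<nu>"

(* English convention, indexed from 0: the cell (i, j) is in row i and column j. *)
definition young_diagram :: "nat list \<Rightarrow> (nat \<times> nat) set" where
  "young_diagram \<nu> = {(i, j). i < length \<nu> \<and> j < \<nu> ! i}"

(* The cell c itself together with the cells to its right and the cells below it. *)
definition hook :: "nat list \<Rightarrow> nat \<times> nat \<Rightarrow> (nat \<times> nat) set" where
  "hook \<nu> c = {d \<in> young_diagram \<nu>.
     fst d = fst c \<and> snd c \<le> snd d \<or> snd d = snd c \<and> fst c \<le> fst d}"

definition hook_length :: "nat list \<Rightarrow> nat \<times> nat \<Rightarrow> nat" where
  "hook_length \<nu> c = card (hook \<nu> c)"

definition is_core :: "nat \<Rightarrow> nat list \<Rightarrow> bool" where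
  "is_core p \<nu> \<longleftrightarrow> (\<forall>c \<in> young_diagram \<nu>. \<not> p dvd hook_length \<nu> c)"

(* The p'-partitions. *)
definition is_prime_to :: "nat \<Rightarrow> nat list \<Rightarrow> bool" where
  "is_prime_to p \<nu> \<longleftrightarrow> (\<forall>x \<in> set \<nu>. \<not> p dvd x)"

(* Maximality refers to the size only, so no uniqueness is built in. *)
definition is_maximal_core_prime_to :: "nat \<Rightarrow> nat list \<Rightarrow> bool" where
  "is_maximal_core_prime_to p \<nu> \<longleftrightarrow>
     is_arg_max partition_size (\<lambda>\<mu>. is_partition \<mu> \<and> is_core p \<mu> \<and> is_prime_to p \<mu>) \<nu>"

end

theory Submission
  imports Defs "HOL-Number_Theory.Cong"
begin

text \<open>
  A p-core is encoded by the finite set of its beads (first column hook lengths), which is closed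
  under subtraction of p; a part is the number of gaps below its bead. Cut the positions into rows
  of length p and let r(g) be the number of rows with exactly g gaps. Following the last surviving
  bead down the rows with g gaps, the parts run through an arithmetic progression with difference g
  modulo p that must avoid 0, so the deficit d(g) = p - r(g) is positive. Up to lower order terms the size is
  p^6 / 24 minus the sum of p^2 g (p - g) d(g) / 2.

  Upper bound: passing from g to g + 1 gaps forces a relation p | e g + t with
  0 \<le> t \<le> e < d(g) + d(g + 1). For each s at most s (s + 1) / 2 values of g admit such a relation with e < s;
  with s close to sqrt p / 2 most g therefore have d(g) + d(g + 1) \<ge> s.

  Lower bound: let the beads of a row with g gaps occupy the runners 1, ..., p - g. A pair u > 0, v \<ge> 0
  with p | u (g + 1) + v g allows the rows with g gaps to stop v steps early and those with g + 1 gaps to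
  start u steps late, so that the deficits sum to the sum of all u + v. The pigeonhole principle gives a short
  relation with |u|, |v| \<le> sqrt p; if its signs are mixed, it still yields an admissible
  pair with u + v \<le> 2 p / max (|u|, |v|), and distinct g have distinct short relations, so that the total deficit
  is at most about 6 p sqrt p.
\<close>

section \<open>Partitions and bead sets\<close>

definition gaps_below :: "nat set \<Rightarrow> nat \<Rightarrow> nat" where
  "gaps_below X b = card ({..<b} - X)"

text \<open>\<open>rev\<close> puts the largest bead first, so that the parts weakly decrease. For
  finite \<open>X\<close> a zero part arises exactly when \<open>0 \<in> X\<close>, which explains
  the recurring condition \<open>0 \<notin> X\<close>.\<close>

definition beta_partition :: "nat set \<Rightarrow> nat list" where
  "beta_partition X = map (gaps_below X) (rev (sorted_list_of_set X))"

lemma gaps_below_0 [simp]: "gaps_below X 0 = 0"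
  by (simp add: gaps_below_def)

lemma gaps_below_Suc: "gaps_below X (Suc b) = gaps_below X b + (if b \<in> X then 0 else 1)"
  by (simp add: gaps_below_def lessThan_Suc insert_Diff_if)

lemma gaps_below_mono: "a \<le> b \<Longrightarrow> gaps_below X a \<le> gaps_below X b"
  unfolding gaps_below_def by (intro card_mono) auto

lemma gaps_below_less: "y \<notin> X \<Longrightarrow> y < b \<Longrightarrow> gaps_below X y < gaps_below X b"
  using gaps_below_Suc[of X y] gaps_below_mono[of "Suc y" b X] by simp

text \<open>Gaps serve as column labels: an arbitrary cell in the row of bead \<open>b\<close> comes
  from a gap below \<open>b\<close>.\<close>

lemma ex_gap: "j < gaps_below X b \<Longrightarrow> \<exists>y<b. y \<notin> X \<and> gaps_below X y = j"
proof (induction b)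
  case (Suc b)
  show ?case
  proof (cases "j < gaps_below X b")
    case True
    then show ?thesis using Suc.IH less_SucI by blast
  next
    case False
    with Suc.prems have "b \<notin> X" "gaps_below X b = j"
      by (auto simp: gaps_below_Suc split: if_splits)
    then show ?thesis by blast
  qed
qed simp

lemma gaps_below_add_beads: "gaps_below X b + card {x \<in> X. x < b} = b"
proof -
  have "card ({..<b} - X) + card ({..<b} \<inter> X) = card {..<b}"
    by (metis add.commute card_Diff_subset_Int card_mono finite_Int finite_lessThan inf_le1
        le_add_diff_inverse)
  moreover have "{..<b} \<inter> X = {x \<in> X. x < b}" by auto
  ultimately show ?thesis by (simp add: gaps_below_def)
qed

lemma length_beta_partition [simp]: "length (beta_partition X) = card X"
  by (simp add: beta_partition_def)

lemma set_beta_partition: "finite X \<Longrightarrow> set (beta_partition X) = gaps_below X ` X"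
  by (simp add: beta_partition_def)

lemma partition_size_beta: "finite X \<Longrightarrow> partition_size (beta_partition X) = (\<Sum>b\<in>X. gaps_below X b)"
  by (simp add: partition_size_def beta_partition_def sum_list_distinct_conv_sum_set)

lemma is_partition_beta:
  assumes "finite X" "0 \<notin> X"
  shows "is_partition (beta_partition X)"
proof -
  have "sorted (map (gaps_below X) (sorted_list_of_set X))"
    by (rule sorted_map_mono) (auto intro: mono_onI gaps_below_mono)
  hence "sorted_wrt (\<ge>) (beta_partition X)"
    by (simp add: beta_partition_def sorted_wrt_rev flip: rev_map)
  moreover have "gaps_below X b \<noteq> 0" if "b \<in> X" for b
    using gaps_below_less[of 0 X b] assms that by (cases b) auto
  ultimately show ?thesis
    unfolding is_partition_def set_beta_partition[OF assms(1)] by (metis imageE)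
qed

text \<open>The numbers \<open>\<nu> ! i + (n - 1 - i)\<close> strictly decrease in
  \<open>i\<close>, so exactly \<open>n - 1 - i\<close> of them lie below the bead of row
  \<open>i\<close>, which leaves \<open>\<nu> ! i\<close> gaps there. Positivity of the parts keeps
  0 out of the bead set.\<close>

lemma ex_beta_partition:
  assumes "is_partition \<nu>"
  shows "\<exists>X. finite X \<and> 0 \<notin> X \<and> \<nu> = beta_partition X"
proof -
  define n where "n = length \<nu>"
  define \<beta> where "\<beta> i = \<nu> ! i + (n - 1 - i)" for i
  define X where "X = \<beta> ` {..<n}"
  have anti: "\<nu> ! j \<le> \<nu> ! i" if "i \<le> j" "j < n" for i j
    using assms that sorted_wrt_nth_less[of "(\<ge>)" \<nu> i j]
    by (cases "i = j") (auto simp: is_partition_def n_def)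
  have less: "\<beta> j < \<beta> i" if "i < j" "j < n" for i j
    using anti[of i j] that by (simp add: \<beta>_def)
  have less_iff: "\<beta> j < \<beta> i \<longleftrightarrow> i < j" if "i < n" "j < n" for i j
    using less[of i j] less[of j i] that by (cases i j rule: linorder_cases) auto
  have inj: "inj_on \<beta> {..<n}"
    by (rule linorder_inj_onI') (use less in force)
  have gaps: "gaps_below X (\<beta> i) = \<nu> ! i" if "i < n" for i
  proof -
    have "{x \<in> X. x < \<beta> i} = \<beta> ` {Suc i..<n}"
      using less_iff that unfolding X_def by auto
    hence "card {x \<in> X. x < \<beta> i} = n - Suc i"
      using inj by (simp add: card_image inj_on_subset subset_eq)
    thus ?thesis
      using gaps_below_add_beads[of X "\<beta> i"] that by (simp add: \<beta>_def)
  qed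
  have "sorted_wrt (<) (rev (map \<beta> [0..<n]))"
    unfolding sorted_wrt_rev sorted_wrt_map
    by (rule sorted_wrt_mono_rel[of _ "(<)"]) (auto intro: less)
  moreover have "set (rev (map \<beta> [0..<n])) = X"
    by (auto simp: X_def)
  ultimately have "sorted_list_of_set X = rev (map \<beta> [0..<n])"
    by (metis sorted_list_of_set.idem_if_sorted_distinct strict_sorted_iff)
  hence "beta_partition X = map (gaps_below X \<circ> \<beta>) [0..<n]"
    by (simp add: beta_partition_def)
  also have "\<dots> = map (\<lambda>i. \<nu> ! i) [0..<n]"
    by (intro map_cong) (auto simp: gaps)
  also have "\<dots> = \<nu>" by (simp add: n_def map_nth)
  finally have "\<nu> = beta_partition X" by simp
  moreover have "0 < \<beta> i" if "i < n" for i
    using assms that nth_mem[of i \<nu>] unfolding is_partition_def n_def \<beta>_def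
    by (metis add_gr_0 neq0_conv)
  hence "0 \<notin> X" unfolding X_def by force
  ultimately show ?thesis unfolding X_def by blast
qed

section \<open>Hook lengths and the core condition in terms of beads\<close>

text \<open>With \<open>b\<close> the bead of row \<open>i\<close>, the cell and its arm correspond
  to the gaps from \<open>y\<close> up to \<open>b\<close>, the leg to the beads strictly between
  \<open>y\<close> and \<open>b\<close>. Together they exhaust the \<open>b - y\<close> positions
  from \<open>y\<close> to \<open>b - 1\<close>.\<close>

lemma hook_length_beta:
  assumes "finite X" and i: "i < card X" and y: "y \<notin> X" "y < rev (sorted_list_of_set X) ! i"
  shows "hook_length (beta_partition X) (i, gaps_below X y) = rev (sorted_list_of_set X) ! i - y"
proof -
  let ?l = "rev (sorted_list_of_set X)"
  let ?\<nu> = "beta_partition X"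
  let ?j = "gaps_below X y"
  define b where "b = ?l ! i"
  have nu: "?\<nu> ! k = gaps_below X (?l ! k)" if "k < card X" for k
    using that by (simp add: beta_partition_def)
  have dec: "?l ! k < ?l ! k'" if "k' < k" "k < card X" for k k'
  proof -
    have "sorted_wrt (>) ?l" by (simp add: sorted_wrt_rev)
    from sorted_wrt_nth_less[OF this that(1)] that show ?thesis by simp
  qed
  have dec_iff: "?l ! k < ?l ! k' \<longleftrightarrow> k' < k" if "k < card X" "k' < card X" for k k'
    using dec[of k' k] dec[of k k'] that by (cases k k' rule: linorder_cases) auto
  have inj: "inj_on ((!) ?l) {..<card X}"
    by (rule linorder_inj_onI') (use dec in force)
  have im: "(!) ?l ` {..<card X} = X"
  proof -
    have "(!) ?l ` {..<card X} = set ?l"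
      unfolding set_conv_nth by auto
    thus ?thesis using assms by simp
  qed
  \<comment> \<open>The row of bead \<open>x\<close> reaches the column of gap \<open>y\<close>
    exactly when \<open>y\<close> lies below \<open>x\<close>.\<close>
  have less_iff: "?j < gaps_below X x \<longleftrightarrow> y < x" if "x \<in> X" for x
    using gaps_below_less[OF y(1), of x] gaps_below_mono[of x y X] by fastforce
  define A where "A = {(i, j') | j'. ?j \<le> j' \<and> j' < gaps_below X b}"
  define L where "L = {(k, ?j) | k. i < k \<and> k < card X \<and> ?j < ?\<nu> ! k}"
  have hk: "hook ?\<nu> (i, ?j) = A \<union> L"
    using i less_iff[of b] gaps_below_less[OF y]
    unfolding hook_def young_diagram_def A_def L_def b_def by (auto simp: nu le_less)
  have A: "A = Pair i ` {?j..<gaps_below X b}" unfolding A_def by auto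
  hence "card A = gaps_below X b - ?j" by (simp add: card_image inj_on_def)
  define L' where "L' = {k. i < k \<and> k < card X \<and> ?j < ?\<nu> ! k}"
  have L: "L = (\<lambda>k. (k, ?j)) ` L'" unfolding L_def L'_def by auto
  have cardL: "card L = card L'" unfolding L by (simp add: card_image inj_on_def)
  have "(!) ?l ` L' = {x \<in> X. y < x \<and> x < b}"
  proof (intro equalityI subsetI)
    fix x assume "x \<in> (!) ?l ` L'"
    then obtain k where k: "k < card X" "i < k" "?j < ?\<nu> ! k" "x = ?l ! k"
      unfolding L'_def by auto
    have "x \<in> X" using k im by blast
    with k show "x \<in> {x \<in> X. y < x \<and> x < b}" using less_iff[of x] nu dec by (auto simp: b_def)
  next
    fix x assume x: "x \<in> {x \<in> X. y < x \<and> x < b}"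
    then obtain k where k: "k < card X" "x = ?l ! k" using im by blast
    have "i < k" using x k i dec_iff[of k i] by (auto simp: b_def)
    with x k show "x \<in> (!) ?l ` L'" using less_iff[of x] nu by (auto simp: L'_def)
  qed
  moreover have "inj_on ((!) ?l) L'" using inj by (rule inj_on_subset) (auto simp: L'_def)
  ultimately have "card L' = card {x \<in> X. y < x \<and> x < b}"
    using card_image by metis
  hence "card L = card {x \<in> X. y < x \<and> x < b}" using cardL by simp
  moreover have "card {x \<in> X. x < b} = card {x \<in> X. x < y} + card {x \<in> X. y < x \<and> x < b}"
  proof -
    have "{x \<in> X. x < b} = {x \<in> X. x < y} \<union> {x \<in> X. y < x \<and> x < b}"
      using y by (auto simp: b_def) (metis linorder_neqE_nat)
    thus ?thesis using assms(1) by (simp add: card_Un_disjoint disjoint_iff)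
  qed
  moreover have "finite A" "finite L" "A \<inter> L = {}"
    unfolding A L L'_def by (auto)
  ultimately have "hook_length ?\<nu> (i, ?j) = (gaps_below X b - ?j) + (card {x \<in> X. x < b} - card {x \<in> X. x < y})"
    using \<open>card A = _\<close> by (simp add: hook_length_def hk card_Un_disjoint)
  moreover have "card {x \<in> X. x < y} \<le> card {x \<in> X. x < b}"
    using y assms(1) by (intro card_mono) (auto simp: b_def)
  moreover have "?j \<le> gaps_below X b" using y by (intro gaps_below_mono) (simp add: b_def)
  ultimately show ?thesis
    using gaps_below_add_beads[of X b] gaps_below_add_beads[of X y] y(2)
    unfolding b_def[symmetric] by linarith
qed

lemma is_core_beta_iff:
  assumes "finite X"
  shows "is_core p (beta_partition X) \<longleftrightarrow> (\<forall>b\<in>X. \<forall>y<b. y \<notin> X \<longrightarrow> \<not> p dvd b - y)"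
proof -
  let ?l = "rev (sorted_list_of_set X)"
  have mem: "?l ! i \<in> X" if "i < card X" for i
    using nth_mem[of i ?l] that assms by simp
  show ?thesis
  proof
    assume core: "is_core p (beta_partition X)"
    show "\<forall>b\<in>X. \<forall>y<b. y \<notin> X \<longrightarrow> \<not> p dvd b - y"
    proof (intro ballI allI impI)
      fix b y assume b: "b \<in> X" "y < b" "y \<notin> X"
      have "b \<in> set ?l" using b assms by simp
      then obtain i where i: "i < card X" "b = ?l ! i"
        by (metis in_set_conv_nth length_rev sorted_list_of_set.length_sorted_key_list_of_set)
      have "(i, gaps_below X y) \<in> young_diagram (beta_partition X)"
        using gaps_below_less[OF b(3,2)] i by (simp add: young_diagram_def beta_partition_def)
      thus "\<not> p dvd b - y"
        using core hook_length_beta[OF assms i(1) b(3)] b i unfolding is_core_def by metis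
    qed
  next
    assume *: "\<forall>b\<in>X. \<forall>y<b. y \<notin> X \<longrightarrow> \<not> p dvd b - y"
    show "is_core p (beta_partition X)"
      unfolding is_core_def
    proof
      fix c assume "c \<in> young_diagram (beta_partition X)"
      then obtain i j where c: "c = (i, j)" "i < card X" "j < gaps_below X (?l ! i)"
        by (auto simp: young_diagram_def beta_partition_def)
      from ex_gap[OF c(3)] obtain y where "y < ?l ! i" "y \<notin> X" "gaps_below X y = j" by blast
      thus "\<not> p dvd hook_length (beta_partition X) c"
        using hook_length_beta[OF assms c(2), of y] * mem[OF c(2)] c(1) by auto
    qed
  qed
qed

lemma closed_diff_mult:
  fixes p b k :: nat
  assumes closed: "\<forall>b\<in>X. p \<le> b \<longrightarrow> b - p \<in> X" and "b \<in> X" "k * p \<le> b"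
  shows "b - k * p \<in> X"
  using assms(3)
proof (induction k)
  case (Suc k)
  have "k * p + p \<le> b" using Suc.prems by simp
  with Suc.IH have "b - k * p \<in> X" "p \<le> b - k * p" by linarith+
  with closed have "b - k * p - p \<in> X" by blast
  thus ?case by (simp add: diff_diff_left add.commute)
qed (use assms in simp)

text \<open>Hooks are pairs of a bead and a lower gap. The gap \<open>b - p\<close> already yields
  closure; conversely, closure iterated from \<open>b\<close> shows that no position at a distance
  divisible by \<open>p\<close> below \<open>b\<close> is a gap.\<close>

lemma is_core_beta_iff_closed:
  assumes "finite X" "p > 0"
  shows "is_core p (beta_partition X) \<longleftrightarrow> (\<forall>b\<in>X. p \<le> b \<longrightarrow> b - p \<in> X)"
proof -
  have "y = b - k * p \<and> k * p \<le> b" if "b - y = p * k" "y < b" for b y k :: nat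
    using that by (auto simp: mult.commute[of p])
  hence "(\<forall>b\<in>X. p \<le> b \<longrightarrow> b - p \<in> X) \<Longrightarrow> \<forall>b\<in>X. \<forall>y<b. y \<notin> X \<longrightarrow> \<not> p dvd b - y"
    by (metis closed_diff_mult dvdE)
  moreover have "b - p \<in> X" if "\<forall>b\<in>X. \<forall>y<b. y \<notin> X \<longrightarrow> \<not> p dvd b - y" "b \<in> X" "p \<le> b" for b
    using that assms(2) by (metis diff_diff_cancel diff_less dvd_refl le_less_trans less_le_trans)
  ultimately show ?thesis
    unfolding is_core_beta_iff[OF assms(1)] by blast
qed

section \<open>Rows of the abacus\<close>

text \<open>Gaps are recorded by runner index below \<open>p\<close> rather than by position, so
  that different rows can be compared by inclusion.\<close>

definition row_gaps :: "nat \<Rightarrow> nat set \<Rightarrow> nat \<Rightarrow> nat set" where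
  "row_gaps p X k = {i. i < p \<and> k * p + i \<notin> X}"

lemma finite_row_gaps [simp]: "finite (row_gaps p X k)"
  by (simp add: row_gaps_def)

lemma gaps_below_row:
  assumes "i \<le> p"
  shows "gaps_below X (k * p + i) = gaps_below X (k * p) + card (row_gaps p X k \<inter> {..<i})"
proof -
  have "{..<k * p + i} - X = ({..<k * p} - X) \<union> (+) (k * p) ` (row_gaps p X k \<inter> {..<i})"
    (is "_ = ?A \<union> ?B")
  proof (intro equalityI subsetI)
    fix x assume x: "x \<in> {..<k * p + i} - X"
    show "x \<in> ?A \<union> ?B"
    proof (cases "x < k * p")
      case False
      with x assms have "x = k * p + (x - k * p)" "x - k * p \<in> row_gaps p X k \<inter> {..<i}"
        by (auto simp: row_gaps_def)
      thus ?thesis by blast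
    qed (use x in auto)
  qed (auto simp: row_gaps_def)
  moreover have "card (?A \<union> ?B) = card ?A + card ?B"
    by (intro card_Un_disjoint) auto
  moreover have "card ?B = card (row_gaps p X k \<inter> {..<i})"
    by (intro card_image) auto
  ultimately show ?thesis by (simp add: gaps_below_def)
qed

lemma gaps_below_row_start: "gaps_below X (k * p) = (\<Sum>j<k. card (row_gaps p X j))"
proof (induction k)
  case (Suc k)
  have "row_gaps p X k \<inter> {..<p} = row_gaps p X k" by (auto simp: row_gaps_def)
  with gaps_below_row[of p p X k] Suc.IH show ?case by (simp add: add.commute)
qed simp

lemma gaps_below_eq:
  assumes "i \<le> p"
  shows "gaps_below X (k * p + i) = (\<Sum>j<k. card (row_gaps p X j)) + card (row_gaps p X k \<inter> {..<i})"
  using gaps_below_row[OF assms] by (simp add: gaps_below_row_start)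

lemma sum_over_rows:
  fixes f :: "nat \<Rightarrow> 'a::comm_monoid_add"
  assumes "finite X" "p > 0" and K: "\<And>b. b \<in> X \<Longrightarrow> b < K * p"
  shows "(\<Sum>b\<in>X. f b) = (\<Sum>k<K. \<Sum>i\<in>{..<p} - row_gaps p X k. f (k * p + i))"
proof -
  have "(\<Sum>k<K. \<Sum>i\<in>{..<p} - row_gaps p X k. f (k * p + i)) =
        (\<Sum>(k, i)\<in>Sigma {..<K} (\<lambda>k. {..<p} - row_gaps p X k). f (k * p + i))"
    by (intro sum.Sigma) auto
  also have "\<dots> = (\<Sum>b\<in>X. f b)"
    using assms K
    by (intro sum.reindex_bij_witness[of _ "\<lambda>b. (b div p, b mod p)" "\<lambda>(k, i). k * p + i"])
       (auto simp: row_gaps_def less_mult_imp_div_less)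
  finally show ?thesis by simp
qed

lemma card_row_beads: "card ({..<p} - row_gaps p X k) = p - card (row_gaps p X k)"
  by (subst card_Diff_subset) (auto simp: row_gaps_def)

text \<open>The function c below counts the gaps to the left of the runner that carries the largest bead.\<close>

lemma core_prime_to_row_data:
  assumes X: "finite X" "0 \<notin> X" "X \<noteq> {}" and "p > 0"
    and closed: "\<forall>b\<in>X. p \<le> b \<longrightarrow> b - p \<in> X"
    and prime_to: "\<forall>b\<in>X. \<not> p dvd gaps_below X b"
  shows "\<exists>(K :: nat) (g :: nat \<Rightarrow> nat) c.
    (\<forall>k<K. 1 \<le> g k \<and> g k < p \<and> \<not> p dvd (\<Sum>j<k. g j) + c k) \<and>
    (\<forall>k k'. k \<le> k' \<longrightarrow> c k \<le> c k' \<and> g k + c k' \<le> g k' + c k) \<and>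
    (\<Sum>b\<in>X. gaps_below X b) \<le> (\<Sum>k<K. (p - g k) * (\<Sum>j\<le>k. g j))"
proof -
  define m where "m = Max X"
  define K where "K = Suc (m div p)"
  define x where "x = m mod p"
  define g where "g k = card (row_gaps p X k)" for k
  define c where "c k = card (row_gaps p X k \<inter> {..<x})" for k
  have x: "x < p" using \<open>p > 0\<close> by (simp add: x_def)
  note down = closed_diff_mult[OF closed]
  \<comment> \<open>By closure the runner of the largest bead carries a bead in every row; its parts
    are the ones tested for divisibility by \<open>p\<close>.\<close>
  have bead: "k * p + x \<in> X" if "k < K" for k
  proof -
    have "k * p + x = m - (m div p - k) * p"
      using that by (simp add: K_def x_def diff_mult_distrib minus_div_mult_eq_mod flip: minus_div_mult_eq_mod)
    moreover have "m \<in> X" using X by (simp add: m_def)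
    moreover have "(m div p - k) * p \<le> m"
      by (metis diff_le_self div_times_less_eq_dividend le_trans mult_le_mono1)
    ultimately show ?thesis using down by metis
  qed
  \<comment> \<open>A gap persists on its runner in all later rows.\<close>
  have sub: "row_gaps p X k \<subseteq> row_gaps p X k'" if "k \<le> k'" for k k'
  proof
    fix i assume i: "i \<in> row_gaps p X k"
    show "i \<in> row_gaps p X k'"
    proof (rule ccontr)
      assume "i \<notin> row_gaps p X k'"
      hence "k' * p + i \<in> X" using i by (simp add: row_gaps_def)
      from down[OF this, of "k' - k"] have "k' * p + i - (k' - k) * p \<in> X"
        by (simp add: diff_mult_distrib)
      moreover have "k' * p + i - (k' - k) * p = k * p + i"
        using that by (simp add: diff_mult_distrib)
      ultimately show False using i by (simp add: row_gaps_def)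
    qed
  qed
  have split: "g k = c k + card (row_gaps p X k \<inter> {x..})" for k
    unfolding g_def c_def
    by (subst card_Un_disjoint[symmetric]) (auto intro!: arg_cong[of _ _ card])
  \<comment> \<open>The gaps on either side of runner \<open>x\<close> grow separately; the second
    inequality expresses this for the right side without subtraction.\<close>
  have mono: "c k \<le> c k' \<and> g k + c k' \<le> g k' + c k" if "k \<le> k'" for k k'
  proof -
    have "c k \<le> c k'" "card (row_gaps p X k \<inter> {x..}) \<le> card (row_gaps p X k' \<inter> {x..})"
      unfolding c_def using sub[OF that] by (auto intro!: card_mono)
    thus ?thesis by (simp add: split)
  qed
  have row: "1 \<le> g k \<and> g k < p \<and> \<not> p dvd (\<Sum>j<k. g j) + c k" if "k < K" for k
  proof (intro conjI)
    have "0 \<in> row_gaps p X 0" using X \<open>p > 0\<close> by (simp add: row_gaps_def)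
    hence "0 \<in> row_gaps p X k" using sub[of 0 k] by blast
    thus "1 \<le> g k" unfolding g_def by (metis One_nat_def Suc_leI card_gt_0_iff empty_iff finite_row_gaps)
    have "row_gaps p X k \<subset> {..<p}"
      using bead[OF that] x by (auto simp: row_gaps_def)
    from psubset_card_mono[OF _ this] show "g k < p" by (simp add: g_def)
    have "gaps_below X (k * p + x) = (\<Sum>j<k. g j) + c k"
      using gaps_below_eq[of x p X k] x by (simp add: g_def c_def)
    thus "\<not> p dvd (\<Sum>j<k. g j) + c k" using prime_to bead[OF that] by metis
  qed
  have "b < K * p" if "b \<in> X" for b
  proof -
    have "b \<le> m" using that X by (simp add: m_def)
    thus ?thesis unfolding K_def using \<open>p > 0\<close>
      by (metis dividend_less_div_times le_less_trans mult_Suc)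
  qed
  hence "(\<Sum>b\<in>X. gaps_below X b) =
      (\<Sum>k<K. \<Sum>i\<in>{..<p} - row_gaps p X k. gaps_below X (k * p + i))"
    using X \<open>p > 0\<close> by (intro sum_over_rows) auto
  \<comment> \<open>All gaps of row \<open>k\<close> are counted, also those to the right of the
    bead; this costs only lower order terms.\<close>
  also have "\<dots> \<le> (\<Sum>k<K. \<Sum>i\<in>{..<p} - row_gaps p X k. (\<Sum>j\<le>k. g j))"
  proof (intro sum_mono)
    fix k i assume "i \<in> {..<p} - row_gaps p X k"
    hence "gaps_below X (k * p + i) = (\<Sum>j<k. g j) + card (row_gaps p X k \<inter> {..<i})"
      using gaps_below_eq[of i p X k] by (simp add: g_def)
    also have "card (row_gaps p X k \<inter> {..<i}) \<le> g k"
      unfolding g_def by (intro card_mono) auto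
    finally show "gaps_below X (k * p + i) \<le> (\<Sum>j\<le>k. g j)" by (simp add: lessThan_Suc_atMost[symmetric])
  qed
  also have "\<dots> = (\<Sum>k<K. (p - g k) * (\<Sum>j\<le>k. g j))"
    by (simp add: card_row_beads g_def)
  finally have le: "(\<Sum>b\<in>X. gaps_below X b) \<le> (\<Sum>k<K. (p - g k) * (\<Sum>j\<le>k. g j))" .
  show ?thesis
    by (rule exI[of _ K], rule exI[of _ g], rule exI[of _ c]) (use mono row le in auto)
qed

section \<open>Transitions between consecutive gap counts\<close>

text \<open>Take \<open>i\<close> congruent to \<open>-A\<close> times the inverse of
  \<open>g\<close>, with \<open>p - A mod p\<close> standing for \<open>-A\<close>.\<close>

lemma ex_residue_step:
  fixes p g A :: nat
  assumes "coprime g p" "p > 0"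
  shows "\<exists>i<p. p dvd A + i * g"
proof -
  obtain x where x: "[g * x = 1] (mod p)"
    using cong_solve_coprime_nat[OF assms(1)] by auto
  define i where "i = (x * (p - A mod p)) mod p"
  have "[A + i * g = A + (x * (p - A mod p)) * g] (mod p)"
    unfolding i_def by (intro cong_add cong_mult) (auto simp: cong_def)
  also have "A + (x * (p - A mod p)) * g = A + (g * x) * (p - A mod p)" by (simp add: mult_ac)
  also have "[\<dots> = A mod p + 1 * (p - A mod p)] (mod p)"
    by (intro cong_add cong_mult x) (auto simp: cong_def)
  also have "A mod p + 1 * (p - A mod p) = p" using assms(2) by (simp add: less_imp_le)
  finally have "p dvd A + i * g" by (simp add: cong_def dvd_eq_mod_eq_0)
  moreover have "i < p" using assms(2) by (simp add: i_def)
  ultimately show ?thesis by blast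
qed

text \<open>Continued far enough, both progressions hit 0 modulo \<open>p\<close>, at steps
  \<open>i0\<close> and \<open>i1\<close> that the runs do not reach. Subtracting the two
  divisibilities eliminates \<open>N\<close> and leaves a relation whose coefficient
  \<open>e\<close> is less than the sum of the deficits \<open>p - r\<close> and
  \<open>p - r'\<close>.\<close>

lemma consecutive_runs:
  fixes p g r r' N c c' :: nat
  assumes "prime p" "1 \<le> g" "Suc g < p"
    and c: "c \<le> c'" "c' \<le> Suc c"
    and run: "\<And>i. i < r \<Longrightarrow> \<not> p dvd N + i * g + c"
    and run': "\<And>i. i < r' \<Longrightarrow> \<not> p dvd N + r * g + i * Suc g + c'"
  shows "\<exists>e t. 1 \<le> e \<and> e + r + r' < 2 * p \<and> t \<le> e \<and> p dvd e * g + t"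
proof -
  have p: "p > 0" using assms by simp
  have cop: "coprime h p" if "1 \<le> h" "h < p" for h
    using that \<open>prime p\<close> by (metis coprime_commute nat_dvd_not_less prime_imp_coprime_nat zero_less_one
        less_le_trans)
  obtain i0 where i0: "i0 < p" "p dvd (N + c) + i0 * g"
    using ex_residue_step[OF cop[of g] p, of "N + c"] assms by auto
  obtain i1 where i1: "i1 < p" "p dvd (N + r * g + c') + i1 * Suc g"
    using ex_residue_step[OF cop[of "Suc g"] p, of "N + r * g + c'"] assms by auto
  have r: "r \<le> i0" using run[of i0] i0 by (metis add.assoc add.commute not_le)
  have r': "r' \<le> i1" using run'[of i1] i1 by (metis add.assoc add.commute not_le)
  define e where "e = (i0 - r) + (p - i1)"
  \<comment> \<open>Since \<open>p - i1\<close> is at least 1 and \<open>c' - c\<close> at most 1,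
    the subtraction does not truncate.\<close>
  define t where "t = (p - i1) - (c' - c)"
  have 1: "1 \<le> e" using i1 by (simp add: e_def)
  have 2: "e + r + r' < 2 * p" using i0 i1 r r' by (simp add: e_def)
  have 3: "t \<le> e" by (simp add: e_def t_def)
  have "int e * int g + int t = ((int N + int c) + int i0 * int g)
      - ((int N + int r * int g + int c') + int i1 * (int g + 1)) + int p * (int g + 1)"
    using r i1 c by (simp add: e_def t_def of_nat_diff algebra_simps)
  moreover have "int p dvd (int N + int c) + int i0 * int g"
    using i0(2) by (metis of_nat_add of_nat_dvd_iff of_nat_mult)
  moreover have "int p dvd (int N + int r * int g + int c') + int i1 * (int g + 1)"
    using i1(2) by (metis of_nat_add of_nat_dvd_iff of_nat_mult of_nat_Suc add.commute)
  ultimately have "int p dvd int e * int g + int t" by (metis dvd_add dvd_diff dvd_triv_left)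
  hence "int p dvd int (e * g + t)" by simp
  hence "p dvd e * g + t" by (simp only: of_nat_dvd_iff)
  with 1 2 3 show ?thesis by blast
qed

text \<open>For fixed \<open>e\<close> and \<open>t\<close> the coefficient \<open>e\<close> is
  invertible modulo \<open>p\<close>, so at most one \<open>g\<close> qualifies; each
  \<open>e\<close> allows \<open>Suc e\<close> values of \<open>t\<close>.\<close>

lemma card_exceptional_le:
  fixes p s :: nat
  assumes "prime p" "s \<le> p"
  shows "card {g. g < p \<and> (\<exists>e t. 1 \<le> e \<and> e < s \<and> t \<le> e \<and> p dvd e * g + t)} \<le> (\<Sum>e<s. Suc e)"
proof -
  define E where "E e t = {g. g < p \<and> p dvd e * g + t}" for e t
  have E: "card (E e t) \<le> 1" if "1 \<le> e" "e < p" for e t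
  proof -
    have "g = h" if "g \<in> E e t" "h \<in> E e t" for g h
    proof -
      have "[e * g + t = e * h + t] (mod p)" using that by (auto simp: E_def cong_def dvd_eq_mod_eq_0)
      hence "[e * g = e * h] (mod p)" by (simp add: cong_add_rcancel_nat)
      moreover have "coprime e p" using \<open>1 \<le> e\<close> \<open>e < p\<close> \<open>prime p\<close>
        by (metis coprime_commute nat_dvd_not_less prime_imp_coprime_nat zero_less_one less_le_trans)
      ultimately have "[g = h] (mod p)" by (simp add: cong_mult_lcancel_nat)
      thus "g = h" using that by (simp add: E_def cong_def)
    qed
    moreover have "finite (E e t)" by (simp add: E_def)
    ultimately show ?thesis by (simp add: card_le_Suc0_iff_eq)
  qed
  have "{g. g < p \<and> (\<exists>e t. 1 \<le> e \<and> e < s \<and> t \<le> e \<and> p dvd e * g + t)} =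
      (\<Union>e\<in>{1..<s}. \<Union>t\<in>{..e}. E e t)" by (auto simp: E_def)
  also have "card \<dots> \<le> (\<Sum>e\<in>{1..<s}. card (\<Union>t\<in>{..e}. E e t))"
    by (intro card_UN_le) auto
  also have "\<dots> \<le> (\<Sum>e\<in>{1..<s}. \<Sum>t\<in>{..e}. card (E e t))"
    by (intro sum_mono card_UN_le) auto
  also have "\<dots> \<le> (\<Sum>e\<in>{1..<s}. \<Sum>t\<in>{..e}. 1)"
    using assms E by (intro sum_mono) auto
  also have "\<dots> = (\<Sum>e\<in>{1..<s}. Suc e)" by simp
  also have "\<dots> \<le> (\<Sum>e<s. Suc e)" by (intro sum_mono2) auto
  finally show ?thesis .
qed

section \<open>Phases of rows with equal gap count\<close>

lemma sum_real_lessThan: "(\<Sum>i<h. real i) = real h * (real h - 1) / 2"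
  by (induction h) (simp_all add: field_simps)

text \<open>With r h rows having h gaps and n - h beads each, this sums, over all rows, the number of beads
  times the number of gaps in the preceding rows, including the row itself if a = 1 and excluding it
  if a = -1.\<close>

definition phase_weight :: "nat \<Rightarrow> (nat \<Rightarrow> real) \<Rightarrow> real \<Rightarrow> real" where
  "phase_weight n r a = (\<Sum>h<n. real (n - h) *
     (r h * (\<Sum>i<h. real i * r i) + real h * r h * (r h + a) / 2))"

lemma sum_phase_prefix:
  fixes s g :: "nat \<Rightarrow> nat"
  assumes "\<And>k. s h \<le> k \<Longrightarrow> k < s (Suc h) \<Longrightarrow> g k = h" "s h + i \<le> s (Suc h)"
  shows "(\<Sum>j<s h + i. g j) = (\<Sum>j<s h. g j) + i * h"
  using assms(2) by (induction i) (auto simp: assms(1))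

lemma sum_lessThan_add:
  fixes f :: "nat \<Rightarrow> 'a::comm_monoid_add"
  shows "(\<Sum>k<a + b. f k) = (\<Sum>k<a. f k) + (\<Sum>k<b. f (a + k))"
  by (induction b) (simp_all add: add.assoc)

text \<open>\<open>s h\<close> is the index at which the rows with \<open>h\<close> gaps begin.
  Inside such a phase the prefix sums grow linearly, so the inner sum is arithmetic. The share
  \<open>\<epsilon>\<close> of a row's own gaps becomes
  \<open>a = 2 * \<epsilon> - 1\<close>.\<close>

lemma phase_weight_eq:
  fixes s g :: "nat \<Rightarrow> nat"
  assumes s: "s 0 = 0" "mono s"
    and phase: "\<And>h k. h < n \<Longrightarrow> s h \<le> k \<Longrightarrow> k < s (Suc h) \<Longrightarrow> g k = h"
  shows "(\<Sum>k<s n. real (n - g k) * (real (\<Sum>j<k. g j) + \<epsilon> * real (g k))) =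
    phase_weight n (\<lambda>h. real (s (Suc h) - s h)) (2 * \<epsilon> - 1)"
proof -
  define r where "r h = s (Suc h) - s h" for h
  have s_Suc: "s (Suc h) = s h + r h" for h
    using s(2) by (simp add: r_def mono_def)
  have prefix: "(\<Sum>j<s h + i. g j) = (\<Sum>j<s h. g j) + i * h" if "h < n" "i \<le> r h" for h i
    using that phase by (intro sum_phase_prefix) (auto simp: s_Suc)
  have start: "(\<Sum>j<s h. g j) = (\<Sum>i<h. i * r i)" if "h \<le> n" for h
    using that
  proof (induction h)
    case (Suc h)
    thus ?case using prefix[of h "r h"] by (simp add: s_Suc mult.commute)
  qed (simp add: s)
  have split: "(\<Sum>k<s m. f k) = (\<Sum>h<m. \<Sum>i<r h. f (s h + i))" for m and f :: "nat \<Rightarrow> real"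
    by (induction m) (simp_all add: s s_Suc sum_lessThan_add)
  have "(\<Sum>k<s n. real (n - g k) * (real (\<Sum>j<k. g j) + \<epsilon> * real (g k))) =
      (\<Sum>h<n. \<Sum>i<r h. real (n - g (s h + i)) * (real (\<Sum>j<s h + i. g j) + \<epsilon> * real (g (s h + i))))"
    by (rule split)
  also have "\<dots> = (\<Sum>h<n. \<Sum>i<r h. real (n - h) * (real (\<Sum>i<h. i * r i) + real i * real h + \<epsilon> * real h))"
  proof (intro sum.cong refl)
    fix h i assume "h \<in> {..<n}" "i \<in> {..<r h}"
    hence "g (s h + i) = h" "(\<Sum>j<s h + i. g j) = (\<Sum>i<h. i * r i) + i * h"
      using phase[of h "s h + i"] prefix[of h i] start[of h] by (simp_all add: s_Suc)
    thus "real (n - g (s h + i)) * (real (\<Sum>j<s h + i. g j) + \<epsilon> * real (g (s h + i))) =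
       real (n - h) * (real (\<Sum>i<h. i * r i) + real i * real h + \<epsilon> * real h)"
      by (simp only: of_nat_add of_nat_mult)
  qed
  also have "\<dots> = (\<Sum>h<n. real (n - h) * (real (r h) * (\<Sum>i<h. real i * real (r i)) +
      real h * real (r h) * (real (r h) + (2 * \<epsilon> - 1)) / 2))"
  proof (intro sum.cong refl)
    fix h
    show "(\<Sum>i<r h. real (n - h) * (real (\<Sum>i<h. i * r i) + real i * real h + \<epsilon> * real h)) =
      real (n - h) * (real (r h) * (\<Sum>i<h. real i * real (r i)) +
      real h * real (r h) * (real (r h) + (2 * \<epsilon> - 1)) / 2)"
      unfolding sum_distrib_left[symmetric] sum.distrib sum_distrib_right[symmetric] sum_real_lessThan
      by (simp add: field_simps)
  qed
  finally show ?thesis by (simp add: phase_weight_def r_def)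
qed

text \<open>As \<open>g\<close> is monotone, rows with equal gap count are contiguous. Within such a
  phase the tested parts form an arithmetic progression that avoids 0 modulo \<open>p\<close>; this
  bounds its length \<open>r h\<close>, and \<open>consecutive_runs\<close> links neighbouring
  phases.\<close>

lemma row_data_phases:
  fixes g c :: "nat \<Rightarrow> nat"
  assumes "prime p"
    and row: "\<And>k. k < K \<Longrightarrow> 1 \<le> g k \<and> g k < p \<and> \<not> p dvd (\<Sum>j<k. g j) + c k"
    and mono: "\<And>k k'. k \<le> k' \<Longrightarrow> c k \<le> c k' \<and> g k + c k' \<le> g k' + c k"
  shows "\<exists>r :: nat \<Rightarrow> nat. (\<forall>h<p. r h < p) \<and>
    (\<forall>h. 1 \<le> h \<longrightarrow> Suc h < p \<longrightarrow>
      (\<exists>e t. 1 \<le> e \<and> e + r h + r (Suc h) < 2 * p \<and> t \<le> e \<and> p dvd e * h + t)) \<and>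
    real (\<Sum>k<K. (p - g k) * (\<Sum>j\<le>k. g j)) = phase_weight p (\<lambda>h. real (r h)) 1"
proof -
  have g_mono: "g k \<le> g k'" if "k \<le> k'" for k k' using mono[OF that] by linarith
  define s where "s h = card {k. k < K \<and> g k < h}" for h
  have s_iff: "k < s h \<longleftrightarrow> k < K \<and> g k < h" for k h
  proof -
    let ?A = "{k. k < K \<and> g k < h}"
    have "?A = {..<s h}"
    proof (cases "?A = {}")
      case True
      thus ?thesis by (simp only: s_def card.empty lessThan_0)
    next
      case False
      have "?A = {..Max ?A}"
      proof (intro equalityI subsetI)
        fix k assume "k \<in> {..Max ?A}"
        moreover have "Max ?A \<in> ?A" using False by (intro Max_in) auto
        ultimately show "k \<in> ?A" using g_mono[of k "Max ?A"] by auto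
      qed auto
      hence "?A = {..<Suc (Max ?A)}" by (simp only: lessThan_Suc_atMost)
      thus ?thesis unfolding s_def by (metis card_lessThan)
    qed
    thus ?thesis by blast
  qed
  have s0: "s 0 = 0" by (simp add: s_def)
  have s_mono: "mono s"
    unfolding mono_def s_def by (auto intro!: card_mono)
  have "s p = card {..<K}" unfolding s_def using row by (intro arg_cong[of _ _ card]) auto
  hence sp: "s p = K" by simp
  have phase: "g k = h" if "s h \<le> k" "k < s (Suc h)" for h k
    using that s_iff[of k h] s_iff[of k "Suc h"] by auto
  define r where "r h = s (Suc h) - s h" for h
  have s_Suc: "s (Suc h) = s h + r h" for h
    using s_mono by (simp add: r_def mono_def)
  have prefix: "(\<Sum>j<s h + i. g j) = (\<Sum>j<s h. g j) + i * h" if "i \<le> r h" for h i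
    using that phase by (intro sum_phase_prefix) (auto simp: s_Suc)
  have run: "\<not> p dvd (\<Sum>j<s h. g j) + i * h + c (s h)" if "i < r h" for h i
  proof -
    have 1: "s h + i < s (Suc h)" using that by (simp add: s_Suc)
    hence "s h + i < K" by (simp add: s_iff)
    \<comment> \<open>Both \<open>c\<close> and \<open>g - c\<close> are nondecreasing and
      \<open>g\<close> is constant here, hence so is \<open>c\<close>.\<close>
    moreover have "c (s h + i) = c (s h)"
      using mono[of "s h" "s h + i"] phase[of h "s h"] phase[of h "s h + i"] 1 by simp
    ultimately show ?thesis using row[of "s h + i"] prefix[of i h] that by simp
  qed
  have r_less: "r h < p" if "h < p" for h
  proof (cases "h = 0")
    case True
    have "s (Suc 0) = 0" using s_iff[of 0 "Suc 0"] row[of 0] by auto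
    with True that show ?thesis by (simp add: r_def)
  next
    case False
    with that \<open>prime p\<close> have "coprime h p"
      by (metis coprime_commute nat_dvd_not_less prime_imp_coprime_nat neq0_conv)
    from ex_residue_step[OF this, of "(\<Sum>j<s h. g j) + c (s h)"] that
    obtain i where "i < p" "p dvd (\<Sum>j<s h. g j) + c (s h) + i * h" by auto
    with run[of i h] show ?thesis by (metis add.assoc add.commute le_less_trans not_le)
  qed
  have pair: "\<exists>e t. 1 \<le> e \<and> e + r h + r (Suc h) < 2 * p \<and> t \<le> e \<and> p dvd e * h + t"
    if h: "1 \<le> h" "Suc h < p" for h
  proof (cases "r h = 0 \<or> r (Suc h) = 0")
    case True
    \<comment> \<open>If a phase is empty, the trivial relation \<open>e = p\<close>,
      \<open>t = 0\<close> suffices, because the other count is below \<open>p\<close>.\<close>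
    thus ?thesis using r_less[of h] r_less[of "Suc h"] h by (intro exI[of _ p] exI[of _ 0]) auto
  next
    case False
    hence "g (s h) = h" "g (s (Suc h)) = Suc h"
      by (auto intro!: phase simp: s_Suc)
    with mono[of "s h" "s (Suc h)"] have "c (s h) \<le> c (s (Suc h))" "c (s (Suc h)) \<le> Suc (c (s h))"
      using s_mono by (auto simp: mono_def)
    thus ?thesis
      using consecutive_runs[OF \<open>prime p\<close> h, of "c (s h)" "c (s (Suc h))" "r h" "\<Sum>j<s h. g j" "r (Suc h)"]
        run[of _ h] run[of _ "Suc h"] prefix[of "r h" h] by (simp add: s_Suc)
  qed
  have "real (\<Sum>k<K. (p - g k) * (\<Sum>j\<le>k. g j)) =
      (\<Sum>k<s p. real (p - g k) * (real (\<Sum>j<k. g j) + 1 * real (g k)))"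
    by (simp add: sp lessThan_Suc_atMost[symmetric])
  also have "\<dots> = phase_weight p (\<lambda>h. real (r h)) (2 * 1 - 1)"
    unfolding r_def by (rule phase_weight_eq) (use s0 s_mono phase in auto)
  finally have "real (\<Sum>k<K. (p - g k) * (\<Sum>j\<le>k. g j)) = phase_weight p (\<lambda>h. real (r h)) 1" by simp
  with r_less pair show ?thesis by blast
qed

section \<open>The size as a function of the deficits\<close>

text \<open>Exchanging the summations gives \<open>f h\<close> the weight 1 + 2 + ... + (n - h -
  1).\<close>

lemma weighted_prefix_sum:
  fixes f :: "nat \<Rightarrow> real"
  shows "(\<Sum>g<n. real (n - g) * (\<Sum>h<g. f h)) =
    (\<Sum>h<n. f h * (real (n - h) * (real (n - h) - 1) / 2))"
proof (induction n)
  case (Suc n)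
  have prefix: "(\<Sum>g<m. \<Sum>h<Suc g. f h) = (\<Sum>h<m. f h * real (m - h))" for m
  proof (induction m)
    case (Suc m)
    have "(\<Sum>h<Suc m. f h * real (Suc m - h)) = (\<Sum>h<Suc m. f h * real (m - h) + f h)"
      by (intro sum.cong) (auto simp: Suc_diff_le algebra_simps)
    also have "\<dots> = (\<Sum>h<m. f h * real (m - h)) + (\<Sum>h<Suc m. f h)"
      by (simp add: sum.distrib)
    finally show ?case using Suc.IH by simp
  qed simp
  have "(\<Sum>g<Suc n. real (Suc n - g) * (\<Sum>h<g. f h)) =
      (\<Sum>g<Suc n. real (n - g) * (\<Sum>h<g. f h) + (\<Sum>h<g. f h))"
    by (intro sum.cong) (auto simp: Suc_diff_le algebra_simps)
  also have "\<dots> = (\<Sum>g<n. real (n - g) * (\<Sum>h<g. f h)) + (\<Sum>g<Suc n. \<Sum>h<g. f h)"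
    by (simp add: sum.distrib)
  also have "(\<Sum>g<Suc n. \<Sum>h<g. f h) = (\<Sum>g<n. \<Sum>h<Suc g. f h)"
    by (subst sum.lessThan_Suc_shift) simp
  also have "\<dots> = (\<Sum>h<n. f h * real (n - h))" by (rule prefix)
  also have "(\<Sum>g<n. real (n - g) * (\<Sum>h<g. f h)) + (\<Sum>h<n. f h * real (n - h)) =
      (\<Sum>h<n. f h * (real (n - h) * (real (n - h) - 1) / 2) + f h * real (n - h))"
    by (simp only: Suc.IH sum.distrib)
  also have "\<dots> = (\<Sum>h<n. f h * (real (Suc n - h) * (real (Suc n - h) - 1) / 2))"
    by (intro sum.cong refl) (simp add: Suc_diff_le field_simps)
  finally show ?case by simp
qed simp

lemma sum_h_times_complement: "(\<Sum>h<n. real (n - h) * real h) = (real n ^ 3 - real n) / 6"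
proof -
  \<comment> \<open>The free \<open>x\<close> decouples the weight from the summation bound, so that
    induction on \<open>m\<close> applies.\<close>
  have "(\<Sum>h<m. (x - real h) * real h) = x * (real m * (real m - 1) / 2) - real m * (real m - 1) * (2 * real m - 1) / 6" for x m
    by (induction m) (simp_all add: field_simps power2_eq_square)
  from this[of "real n" n] show ?thesis
    by (simp add: of_nat_diff field_simps power3_eq_cube cong: sum.cong_simp)
qed

lemma sum_choose2_times_complement:
  "(\<Sum>h<n. real (n - h) * (real h * (real h - 1) / 2)) = (real n + 1) * real n * (real n - 1) * (real n - 2) / 24"
proof -
  have "(\<Sum>h<m. (x - real h) * (real h * (real h - 1) / 2)) =
      real m * (real m - 1) * (real m - 2) / 6 * (x - 2) - real m * (real m - 1) * (real m - 2) * (real m - 3) / 8" for x m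
    by (induction m) (simp_all add: field_simps)
  from this[of "real n" n] show ?thesis
    by (simp add: of_nat_diff field_simps cong: sum.cong_simp)
qed

text \<open>Expansion by degree in the deficits. A deficit enters linearly once through its own row
  count and once through later prefix sums; the factors \<open>h - 1\<close> and
  \<open>n - h - 1\<close> add up to \<open>n - 2\<close>, which gives the symmetric weight
  \<open>h * (n - h)\<close>. The last sum comes from pairs of rows within one phase.\<close>

lemma phase_weight_deficit:
  fixes d :: "nat \<Rightarrow> real"
  shows "phase_weight n (\<lambda>h. real n - d h) a =
     real n ^ 2 * ((real n + 1) * real n * (real n - 1) * (real n - 2) / 24)
     - real n * (real n - 2) / 2 * (\<Sum>h<n. real h * real (n - h) * d h)
     + (\<Sum>h<n. real (n - h) * (d h * (\<Sum>i<h. real i * d i)))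
     + (\<Sum>h<n. real (n - h) * (real h * (real n - d h) * (real n - d h + a) / 2))"
proof -
  define D where "D h = (\<Sum>i<h. real i * d i)" for h
  have pre: "(\<Sum>i<h. real i * (real n - d i)) = real n * (real h * (real h - 1) / 2) - D h" for h
    unfolding D_def sum_real_lessThan[symmetric] sum_distrib_left
    by (simp add: sum_subtractf algebra_simps)
  have "phase_weight n (\<lambda>h. real n - d h) a =
     (\<Sum>h<n. real n ^ 2 * (real (n - h) * (real h * (real h - 1) / 2))
       - real n * (real (n - h) * D h)
       - real n * (d h * (real (n - h) * (real h * (real h - 1) / 2)))
       + real (n - h) * (d h * D h)
       + real (n - h) * (real h * (real n - d h) * (real n - d h + a) / 2))"
    unfolding phase_weight_def pre
    by (intro sum.cong refl) (simp add: field_simps power2_eq_square)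
  also have "\<dots> = real n ^ 2 * (\<Sum>h<n. real (n - h) * (real h * (real h - 1) / 2))
       - real n * ((\<Sum>h<n. real (n - h) * D h) + (\<Sum>h<n. d h * (real (n - h) * (real h * (real h - 1) / 2))))
       + (\<Sum>h<n. real (n - h) * (d h * D h))
       + (\<Sum>h<n. real (n - h) * (real h * (real n - d h) * (real n - d h + a) / 2))"
    by (simp only: sum.distrib sum_subtractf sum_distrib_left[symmetric] distrib_left)
  also have "(\<Sum>h<n. real (n - h) * D h) + (\<Sum>h<n. d h * (real (n - h) * (real h * (real h - 1) / 2))) =
      (\<Sum>h<n. (real n - 2) / 2 * (real h * real (n - h) * d h))"
    unfolding D_def weighted_prefix_sum sum.distrib[symmetric]
    by (intro sum.cong refl) (simp add: of_nat_diff less_imp_le field_simps)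
  finally show ?thesis
    unfolding D_def sum_choose2_times_complement sum_distrib_left[symmetric] by simp
qed

text \<open>Permits deficits to be lowered to a common cap in the upper bound, which keeps their
  quadratic contribution small.\<close>

lemma phase_weight_mono:
  assumes "\<And>h. h < n \<Longrightarrow> 0 \<le> r h \<and> r h \<le> r' h" "a \<ge> 0"
  shows "phase_weight n r a \<le> phase_weight n r' a"
  unfolding phase_weight_def
proof (intro sum_mono mult_left_mono add_mono)
  fix h assume "h \<in> {..<n}"
  hence h: "h < n" by simp
  have "(\<Sum>i<h. real i * r i) \<le> (\<Sum>i<h. real i * r' i)"
    using assms(1) h by (intro sum_mono mult_left_mono) auto
  moreover have "0 \<le> (\<Sum>i<h. real i * r i)"
    using assms(1) h by (intro sum_nonneg mult_nonneg_nonneg) auto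
  ultimately show "r h * (\<Sum>i<h. real i * r i) \<le> r' h * (\<Sum>i<h. real i * r' i)"
    using assms(1)[OF h] by (intro mult_mono) auto
  show "real h * r h * (r h + a) / 2 \<le> real h * r' h * (r' h + a) / 2"
    using assms(1)[OF h] assms(2) by (intro divide_right_mono mult_mono) auto
qed auto

text \<open>The quadratic term is bounded by replacing each deficit by \<open>\<sigma>\<close>, the
  last sum by dropping the deficits. For \<open>\<sigma>\<close> of order sqrt n both errors are of
  order \<open>n ^ 5\<close>.\<close>

lemma phase_weight_upper:
  fixes d :: "nat \<Rightarrow> real"
  assumes d: "\<And>h. h < n \<Longrightarrow> 0 \<le> d h \<and> d h \<le> \<sigma> \<and> d h \<le> real n"
  shows "phase_weight n (\<lambda>h. real n - d h) 1 \<le>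
     (real n ^ 2 + \<sigma> ^ 2) * ((real n + 1) * real n * (real n - 1) * (real n - 2) / 24)
     + (real n ^ 2 + real n) / 2 * ((real n ^ 3 - real n) / 6)
     - real n * (real n - 2) / 2 * (\<Sum>h<n. real h * real (n - h) * d h)"
proof -
  have "(\<Sum>h<n. real (n - h) * (d h * (\<Sum>i<h. real i * d i))) \<le>
      (\<Sum>h<n. real (n - h) * (\<sigma> * (\<sigma> * (real h * (real h - 1) / 2))))"
  proof (intro sum_mono mult_left_mono)
    fix h assume "h \<in> {..<n}"
    hence h: "h < n" by simp
    have "(\<Sum>i<h. real i * d i) \<le> (\<Sum>i<h. real i * \<sigma>)"
      using d h by (intro sum_mono mult_left_mono) auto
    also have "\<dots> = \<sigma> * (real h * (real h - 1) / 2)"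
      by (simp add: sum_distrib_right[symmetric] sum_real_lessThan)
    finally show "d h * (\<Sum>i<h. real i * d i) \<le> \<sigma> * (\<sigma> * (real h * (real h - 1) / 2))"
      using d[OF h] d h order_trans[of 0 "d h" \<sigma>] by (intro mult_mono) (auto intro!: sum_nonneg)
  qed auto
  also have "\<dots> = \<sigma> ^ 2 * (\<Sum>h<n. real (n - h) * (real h * (real h - 1) / 2))"
    unfolding sum_distrib_left by (intro sum.cong) (auto simp: power2_eq_square)
  finally have 1: "(\<Sum>h<n. real (n - h) * (d h * (\<Sum>i<h. real i * d i))) \<le>
      \<sigma> ^ 2 * ((real n + 1) * real n * (real n - 1) * (real n - 2) / 24)"
    by (simp only: sum_choose2_times_complement)
  have "(\<Sum>h<n. real (n - h) * (real h * (real n - d h) * (real n - d h + 1) / 2)) \<le>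
      (\<Sum>h<n. real (n - h) * (real h * real n * (real n + 1) / 2))"
  proof (intro sum_mono mult_left_mono divide_right_mono)
    fix h assume "h \<in> {..<n}"
    thus "real h * (real n - d h) * (real n - d h + 1) \<le> real h * real n * (real n + 1)"
      using d[of h] by (intro mult_mono) auto
  qed auto
  also have "\<dots> = (real n ^ 2 + real n) / 2 * (\<Sum>h<n. real (n - h) * real h)"
    unfolding sum_distrib_left by (intro sum.cong) (auto simp: power2_eq_square field_simps)
  finally have 2: "(\<Sum>h<n. real (n - h) * (real h * (real n - d h) * (real n - d h + 1) / 2)) \<le>
      (real n ^ 2 + real n) / 2 * ((real n ^ 3 - real n) / 6)"
    by (simp only: sum_h_times_complement)
  show ?thesis
    using 1 2 unfolding phase_weight_deficit distrib_right[of "real n ^ 2"] by linarith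
qed

lemma phase_weight_lower:
  fixes r :: "nat \<Rightarrow> nat"
  assumes r: "\<And>h. h < n \<Longrightarrow> r h \<le> n"
  shows "phase_weight n (\<lambda>h. real (r h)) (-1) \<ge>
     real n ^ 2 * ((real n + 1) * real n * (real n - 1) * (real n - 2) / 24)
     - real n * (real n - 2) / 2 * (\<Sum>h<n. real h * real (n - h) * (real n - real (r h)))"
proof -
  have "0 \<le> (\<Sum>h<n. real (n - h) * ((real n - real (r h)) * (\<Sum>i<h. real i * (real n - real (r i)))))"
    using r by (intro sum_nonneg mult_nonneg_nonneg) (auto simp: order.strict_trans)
  moreover have "0 \<le> (\<Sum>h<n. real (n - h) * (real h * (real n - (real n - real (r h))) * (real n - (real n - real (r h)) + -1) / 2))"
  proof (intro sum_nonneg mult_nonneg_nonneg)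
    fix h
    \<comment> \<open>Integrality of \<open>r h\<close> matters: \<open>x * (x - 1)\<close> is
      negative for real \<open>x\<close> between 0 and 1.\<close>
    have "0 \<le> real (r h) * (real (r h) - 1)" by (cases "r h") auto
    thus "0 \<le> real h * (real n - (real n - real (r h))) * (real n - (real n - real (r h)) + -1) / 2"
      by (simp add: mult.assoc)
  qed auto
  ultimately show ?thesis
    using phase_weight_deficit[of n "\<lambda>h. real n - real (r h)" "-1"] by simp
qed

section \<open>Upper bound\<close>

text \<open>The product is concave in \<open>h\<close> and equals the bound at \<open>p / 6\<close>
  and \<open>5 * p / 6\<close>.\<close>

lemma middle_weight:
  fixes h p :: nat
  assumes "p \<le> 6 * h" "6 * h \<le> 5 * p"
  shows "real h * real (p - h) \<ge> 5 / 36 * real p ^ 2"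
proof -
  have "0 \<le> (6 * real h - real p) * (5 * real p - 6 * real h)"
    using assms by (intro mult_nonneg_nonneg) linarith+
  also have "\<dots> = 36 * (real h * real (p - h)) - 5 * real p ^ 2"
    using assms by (simp add: of_nat_diff algebra_simps power2_eq_square)
  finally show ?thesis by simp
qed

text \<open>Outside the exceptional set \<open>E\<close> the relation has \<open>e \<ge> s\<close>,
  so the capped deficits at \<open>g\<close> and \<open>g + 1\<close> sum to at least
  \<open>s\<close>. The middle range has about \<open>2 * p / 3\<close> values, of which
  \<open>E\<close> removes at most about \<open>p / 8\<close>.\<close>

lemma total_deficit_ge:
  fixes p :: nat and r :: "nat \<Rightarrow> nat"
  assumes "prime p" "p > 10 ^ 6"
    and pair: "\<And>h. 1 \<le> h \<Longrightarrow> Suc h < p \<Longrightarrow>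
      \<exists>e t. 1 \<le> e \<and> e + r h + r (Suc h) < 2 * p \<and> t \<le> e \<and> p dvd e * h + t"
    and r: "\<And>h. h < p \<Longrightarrow> r h < p"
    and s: "real s \<le> sqrt (real p) / 2" "sqrt (real p) / 2 - 1 \<le> real s"
  shows "(\<Sum>h<p. real h * real (p - h) * real (min (p - r h) s)) \<ge> 187 / 10000 * real p ^ 3 * sqrt (real p)"
proof -
  define q where "q = sqrt (real p)"
  define d where "d h = min (p - r h) s" for h
  define w where "w h = real h * real (p - h)" for h
  define E where "E = {g. g < p \<and> (\<exists>e t. 1 \<le> e \<and> e < s \<and> t \<le> e \<and> p dvd e * g + t)}"
  \<comment> \<open>The lower end is \<open>p / 6\<close> rounded up; the upper end is excluded so
    that \<open>Suc g\<close> also lies in the middle range.\<close>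
  define M where "M = {(p + 5) div 6..<(5 * p) div 6}"
  have q2: "q ^ 2 = real p" by (simp add: q_def)
  have q1: "q \<ge> 1000"
    unfolding q_def using assms(2) by (intro real_le_rsqrt) simp
  have qp: "1000 * q \<le> real p" using q1 q2 by (simp add: power2_eq_square mult_right_mono flip: q2)
  have "s \<le> p" using s(1) q1 qp unfolding q_def[symmetric] by linarith
  have finE: "finite E" by (simp add: E_def)
  have gauss: "real (\<Sum>e<m. Suc e) = real m * (real m + 1) / 2" for m
    by (induction m) (simp_all add: field_simps)
  have "card E \<le> (\<Sum>e<s. Suc e)"
    unfolding E_def by (rule card_exceptional_le) fact+
  hence "real (card E) \<le> real s * (real s + 1) / 2"
    unfolding gauss[symmetric] of_nat_le_iff .
  also have "\<dots> \<le> (q / 2) * (q / 2 + 1) / 2"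
    using s q1 by (intro divide_right_mono mult_mono) (auto simp: q_def)
  also have "\<dots> = real p / 8 + q / 4" by (simp add: q2[symmetric] power2_eq_square field_simps)
  finally have cardE: "real (card E) \<le> real p / 8 + q / 4" .
  have "card M + (p + 5) div 6 \<ge> (5 * p) div 6" by (simp add: M_def)
  moreover have div6: "6 * (m div 6) \<le> m" "m < 6 * (m div 6) + 6" for m :: nat
    by linarith+
  ultimately have "6 * card M + 15 \<ge> 4 * p"
    using div6(1)[of "p + 5"] div6(2)[of "5 * p"] by linarith
  hence "6 * real (card M) + 15 \<ge> 4 * real p" by linarith
  moreover have "card M \<le> card (M - E) + card E"
    using diff_card_le_card_Diff[OF finE, of M] by linarith
  ultimately have cardA: "real (card (M - E)) \<ge> 54 / 100 * real p"
    using cardE qp q1 by linarith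
  have M: "1 \<le> g \<and> Suc g < p \<and> p \<le> 6 * g \<and> 6 * Suc g \<le> 5 * p" if "g \<in> M" for g
  proof -
    have "(p + 5) div 6 \<le> g" "Suc g \<le> (5 * p) div 6" using that by (auto simp: M_def)
    moreover from this(2) have "6 * Suc g \<le> 5 * p"
      using div6(1)[of "5 * p"] by (meson mult_le_mono2 order_trans)
    moreover have "p > 6" using assms(2) by simp
    ultimately show ?thesis
      using div6(2)[of "p + 5"] div6(1)[of "5 * p"] by (intro conjI) linarith+
  qed
  have step: "w g * real (d g) + w (Suc g) * real (d (Suc g)) \<ge> 5 / 36 * real p ^ 2 * real s"
    if g: "g \<in> M - E" for g
  proof -
    have gM: "1 \<le> g" "Suc g < p" "p \<le> 6 * g" "6 * Suc g \<le> 5 * p" using M[of g] g by auto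
    obtain e t where e: "1 \<le> e" "e + r g + r (Suc g) < 2 * p" "t \<le> e" "p dvd e * g + t"
      using pair[OF gM(1,2)] by blast
    have "\<not> e < s" using g e gM(2) unfolding E_def by auto
    hence "s \<le> d g + d (Suc g)" using e(2) r[of g] r[of "Suc g"] gM(2) unfolding d_def by linarith
    hence "5 / 36 * real p ^ 2 * real s \<le> 5 / 36 * real p ^ 2 * (real (d g) + real (d (Suc g)))"
      by (intro mult_left_mono) auto
    also have "\<dots> \<le> w g * real (d g) + w (Suc g) * real (d (Suc g))"
      unfolding w_def distrib_left using gM by (intro add_mono mult_right_mono middle_weight) auto
    finally show ?thesis .
  qed
  have A: "M - E \<subseteq> {..<p}" "Suc ` (M - E) \<subseteq> {..<p}" using M by force+
  have "54 / 100 * real p * (5 / 36 * real p ^ 2 * real s) \<le> real (card (M - E)) * (5 / 36 * real p ^ 2 * real s)"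
    using cardA by (intro mult_right_mono) auto
  also have "\<dots> \<le> (\<Sum>g\<in>M - E. w g * real (d g) + w (Suc g) * real (d (Suc g)))"
    using step by (intro sum_bounded_below) auto
  also have "\<dots> = (\<Sum>g\<in>M - E. w g * real (d g)) + (\<Sum>g\<in>Suc ` (M - E). w g * real (d g))"
    by (simp add: sum.distrib sum.reindex)
  \<comment> \<open>Each index occurs at most once as \<open>g\<close> and once as
    \<open>Suc g\<close>, hence the factor 2.\<close>
  also have "\<dots> \<le> (\<Sum>h<p. w h * real (d h)) + (\<Sum>h<p. w h * real (d h))"
    using A by (intro add_mono sum_mono2) (auto simp: w_def)
  finally have *: "75 / 1000 * (real p ^ 3 * real s) \<le> 2 * (\<Sum>h<p. w h * real (d h))"
    by (simp add: power3_eq_cube power2_eq_square)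
  have "499 / 1000 * q \<le> real s" using s q1 unfolding q_def by linarith
  hence "real p ^ 3 * (499 / 1000 * q) \<le> real p ^ 3 * real s"
    by (intro mult_left_mono) auto
  moreover have "0 \<le> real p ^ 3 * q" using q1 by simp
  ultimately have "187 / 10000 * (real p ^ 3 * q) \<le> (\<Sum>h<p. w h * real (d h))" using * by linarith
  thus ?thesis by (simp only: mult.assoc w_def d_def q_def)
qed

text \<open>With the cap at half of sqrt p the loss has coefficient 187/20000, more than 1/200. As
  sqrt p is at least 1000, the surplus absorbs \<open>P ^ 5 / 96\<close> and the lower
  powers.\<close>

lemma phase_weight_less:
  fixes p :: nat and r :: "nat \<Rightarrow> nat"
  assumes "prime p" "p > 10 ^ 6"
    and pair: "\<And>h. 1 \<le> h \<Longrightarrow> Suc h < p \<Longrightarrow>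
      \<exists>e t. 1 \<le> e \<and> e + r h + r (Suc h) < 2 * p \<and> t \<le> e \<and> p dvd e * h + t"
    and r: "\<And>h. h < p \<Longrightarrow> r h < p"
  shows "phase_weight p (\<lambda>h. real (r h)) 1 < 1 / 24 * real p ^ 6 - 1 / 200 * real p ^ 5 * sqrt (real p)"
proof -
  define q where "q = sqrt (real p)"
  define s where "s = nat \<lfloor>q / 2\<rfloor>"
  define d where "d h = real (min (p - r h) s)" for h
  define P where "P = real p"
  have q2: "q ^ 2 = P" by (simp add: q_def P_def)
  have q1: "q \<ge> 1000"
    unfolding q_def using assms(2) by (intro real_le_rsqrt) simp
  have P: "P \<ge> 1000000" using assms(2) by (simp add: P_def)
  have s: "real s \<le> q / 2" "q / 2 - 1 \<le> real s" using q1 unfolding s_def by linarith+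
  have L: "(\<Sum>h<p. real h * real (p - h) * d h) \<ge> 187 / 10000 * P ^ 3 * q"
    unfolding d_def P_def q_def
    by (rule total_deficit_ge) (use assms s in \<open>auto simp: q_def\<close>)
  have "phase_weight p (\<lambda>h. real (r h)) 1 \<le> phase_weight p (\<lambda>h. real p - d h) 1"
    by (rule phase_weight_mono) (auto simp: d_def dest: r)
  also have "\<dots> \<le> (P ^ 2 + (q / 2) ^ 2) * ((P + 1) * P * (P - 1) * (P - 2) / 24)
     + (P ^ 2 + P) / 2 * ((P ^ 3 - P) / 6)
     - P * (P - 2) / 2 * (\<Sum>h<p. real h * real (p - h) * d h)"
    unfolding P_def by (rule phase_weight_upper) (use s in \<open>auto simp: d_def\<close>)
  also have "\<dots> \<le> (P ^ 2 + P / 4) * ((P + 1) * P * (P - 1) * (P - 2) / 24)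
     + (P ^ 2 + P) / 2 * ((P ^ 3 - P) / 6)
     - P * (P - 2) / 2 * (187 / 10000 * P ^ 3 * q)"
    using L P by (intro diff_mono mult_left_mono) (auto simp: q2 power_divide)
  also have "\<dots> < 1 / 24 * P ^ 6 - 1 / 200 * P ^ 5 * q"
  proof -
    have loss: "P * (P - 2) / 2 * (187 / 10000 * P ^ 3 * q) =
        187 / 20000 * (P ^ 5 * q) - 187 / 10000 * (P ^ 4 * q)"
      by (simp add: field_simps power_numeral_reduce)
    have main: "(P ^ 2 + P / 4) * ((P + 1) * P * (P - 1) * (P - 2) / 24)
        + (P ^ 2 + P) / 2 * ((P ^ 3 - P) / 6) =
        1 / 24 * P ^ 6 + 1 / 96 * P ^ 5 + 1 / 48 * P ^ 4 - 1 / 96 * P ^ 3 - 1 / 16 * P ^ 2"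
      by (simp add: field_simps power_numeral_reduce)
    have 4: "1000000 * P ^ 4 \<le> P ^ 5"
      using P by (simp add: power_numeral_reduce mult_right_mono)
    have "1000000 * (P ^ 4 * q) \<le> P ^ 5 * q"
      using mult_right_mono[OF 4, of q] q1 by (simp add: mult.assoc)
    moreover have "1000 * P ^ 5 \<le> P ^ 5 * q" using q1 P by simp
    moreover have "0 < P ^ 5" "0 \<le> P ^ 3" "0 \<le> P ^ 2" "0 \<le> P ^ 4" using P by auto
    ultimately show ?thesis unfolding loss main mult.assoc[of "1 / 200" _ q] using 4 by linarith
  qed
  finally show ?thesis unfolding P_def q_def .
qed

section \<open>Short relations modulo p\<close>

text \<open>Choose \<open>x\<close> in 1, ..., U with \<open>V * x\<close> congruent to
  \<open>n\<close> modulo \<open>U\<close>. Since \<open>V * x \<le> U * V < n\<close>, the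
  remainder is a positive multiple of \<open>U\<close>.\<close>

lemma coprime_representation:
  fixes U V n :: nat
  assumes "coprime V U" "1 \<le> U" "U * V < n"
  shows "\<exists>x y. 1 \<le> x \<and> x \<le> U \<and> 1 \<le> y \<and> U * y + V * x = n"
proof -
  obtain i where i: "i < U" "U dvd n + i * V"
    using ex_residue_step[OF assms(1), of n] assms by auto
  define x where "x = U - i"
  have x: "1 \<le> x" "x \<le> U" "i = U - x" using i by (auto simp: x_def)
  have "V * x \<le> U * V" using x by simp
  with assms(3) have less: "V * x < n" by linarith
  have "i * V + V * x = U * V"
    using x by (simp add: mult.commute[of V] flip: add_mult_distrib)
  hence "n + i * V = (n - V * x) + U * V" using less by linarith
  hence "U dvd n - V * x"
    using i(2) by (metis dvd_add_left_iff dvd_triv_left)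
  then obtain y where y: "n - V * x = U * y" by blast
  with less have "U * y + V * x = n" "1 \<le> y" by (cases y; auto)+
  with x show ?thesis by blast
qed

text \<open>More than \<open>p\<close> pairs \<open>(a, b)\<close> with entries at most
  \<open>q\<close> share \<open>p\<close> residues, so two collide. Their difference has
  coefficients of equal sign (first alternative) or of opposite sign (second, after division by the
  gcd).\<close>

lemma small_relation:
  fixes p g q :: nat
  assumes "prime p" "1 \<le> g" "Suc g < p" "q * q \<le> p" "p < Suc q * Suc q"
  shows "\<exists>U V. 1 \<le> U \<and> U \<le> q \<and> 1 \<le> V \<and> V \<le> q \<and>
    (p dvd U * Suc g + V * g \<or> (coprime U V \<and> U \<noteq> V \<and> [U * Suc g = V * g] (mod p)))"
proof -
  have not_dvd: "p dvd x * y \<Longrightarrow> False" if "1 \<le> x" "x < p" "1 \<le> y" "y < p" for x y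
    using that \<open>prime p\<close> by (metis nat_dvd_not_less prime_dvd_mult_iff less_le_trans zero_less_one)
  have qp: "q < p"
  proof (cases "q \<le> 1")
    case False
    hence "2 * q \<le> q * q" by simp
    thus ?thesis using assms(4) False by linarith
  qed (use assms in linarith)
  let ?f = "\<lambda>(a, b). (a * Suc g + b * g) mod p"
  have "\<not> inj_on ?f ({..q} \<times> {..q})"
  proof
    assume "inj_on ?f ({..q} \<times> {..q})"
    hence "card ({..q} \<times> {..q}) \<le> card {..<p}"
      using assms(3) by (intro card_inj_on_le[of ?f]) auto
    thus False using assms(5) by simp
  qed
  then obtain a b a' b' where ab: "a \<le> q" "b \<le> q" "a' \<le> q" "b' \<le> q" "(a, b) \<noteq> (a', b')"
    "[a * Suc g + b * g = a' * Suc g + b' * g] (mod p)"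
    unfolding inj_on_def cong_def by auto
  \<comment> \<open>By symmetry the pair with the larger first entry is named first.\<close>
  obtain a b a' b' where ab: "a \<le> q" "b \<le> q" "a' \<le> a" "b' \<le> q" "(a, b) \<noteq> (a', b')"
    "[a * Suc g + b * g = a' * Suc g + b' * g] (mod p)"
  proof (cases "a' \<le> a")
    case True
    thus ?thesis using that[of a b a' b'] ab by blast
  next
    case False
    thus ?thesis using that[of a' b' a b] ab by (auto simp: cong_sym_eq)
  qed
  define U where "U = a - a'"
  have a: "a = a' + U" using ab by (simp add: U_def)
  have "[a' * Suc g + (U * Suc g + b * g) = a' * Suc g + b' * g] (mod p)"
    using ab(6) unfolding a add_mult_distrib add.assoc .
  hence rel: "[U * Suc g + b * g = b' * g] (mod p)"
    using cong_add_lcancel_nat by blast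
  show ?thesis
  proof (cases "b' \<le> b")
    case True
    define V where "V = b - b'"
    have b: "b = b' + V" using True by (simp add: V_def)
    have "[(U * Suc g + V * g) + b' * g = 0 + b' * g] (mod p)"
      using rel by (simp add: b add_mult_distrib add_ac)
    hence "[U * Suc g + V * g = 0] (mod p)" using cong_add_rcancel_nat by blast
    hence dvd: "p dvd U * Suc g + V * g" by (simp add: cong_0_iff)
    have "U \<le> q" "V \<le> q" "U \<noteq> 0 \<or> V \<noteq> 0" using ab True by (auto simp: U_def V_def)
    moreover have "V = 0" if "U = 0"
      using that dvd not_dvd[of V g] \<open>V \<le> q\<close> qp assms by (cases "V = 0") auto
    moreover have "U = 0" if "V = 0"
      using that dvd not_dvd[of U "Suc g"] \<open>U \<le> q\<close> qp assms by (cases "U = 0") auto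
    ultimately have "1 \<le> U" "1 \<le> V" by (auto simp: Suc_le_eq)
    with dvd \<open>U \<le> q\<close> \<open>V \<le> q\<close> show ?thesis by blast
  next
    case False
    define V where "V = b' - b"
    have b: "b' = b + V" using False by (simp add: V_def)
    have V: "1 \<le> V" "V \<le> q" using False ab by (auto simp: V_def)
    have "[U * Suc g + b * g = V * g + b * g] (mod p)"
      using rel by (simp add: b add_mult_distrib add_ac)
    hence UV: "[U * Suc g = V * g] (mod p)" using cong_add_rcancel_nat by blast
    have U: "U \<le> q" using ab by (simp add: U_def)
    have "U \<noteq> 0"
    proof
      assume "U = 0"
      with UV have "[V * g = 0] (mod p)" by (simp add: cong_sym_eq)
      thus False using not_dvd[of V g] V qp assms by (simp add: cong_0_iff)
    qed
    \<comment> \<open>The gcd is at most \<open>V < p\<close>, hence invertible modulo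
      \<open>p\<close>, and may be cancelled.\<close>
    define k where "k = gcd U V"
    obtain U' V' where UV': "U = U' * k" "V = V' * k" "coprime U' V'"
      using gcd_coprime_exists[of U V] \<open>U \<noteq> 0\<close> unfolding k_def by auto
    have k0: "1 \<le> k" "1 \<le> U'" "1 \<le> V'"
      using \<open>U \<noteq> 0\<close> V UV' by (simp_all add: Suc_le_eq)
    hence "k \<le> V" using UV' by simp
    hence k: "1 \<le> k" "k < p" "1 \<le> U'" "1 \<le> V'"
      using k0 V qp by auto
    have "U * Suc g = k * (U' * Suc g)" "V * g = k * (V' * g)" by (simp_all only: UV' mult_ac)
    with UV have "[k * (U' * Suc g) = k * (V' * g)] (mod p)" by simp
    moreover have "coprime k p" using k \<open>prime p\<close>
      by (metis coprime_commute nat_dvd_not_less prime_imp_coprime_nat zero_less_one less_le_trans)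
    ultimately have rel': "[U' * Suc g = V' * g] (mod p)" by (simp only: cong_mult_lcancel_nat)
    have "U' \<le> U" "V' \<le> V" using k UV' by simp_all
    \<comment> \<open>Equal coefficients would leave \<open>p dvd U'\<close>, because
      \<open>Suc g\<close> and \<open>g\<close> differ by 1.\<close>
    have "U' \<noteq> V'"
    proof
      assume "U' = V'"
      hence "[U' + V' * g = 0 + V' * g] (mod p)" using rel' by simp
      hence "[U' = 0] (mod p)" using cong_add_rcancel_nat by blast
      hence "p dvd U'" by (simp add: cong_0_iff)
      hence "p \<le> U'" using k by (intro dvd_imp_le) auto
      thus False using \<open>U' \<le> U\<close> U qp by linarith
    qed
    moreover have "U' \<le> q" "V' \<le> q" using \<open>U' \<le> U\<close> \<open>V' \<le> V\<close> U V by linarith+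
    ultimately show ?thesis using rel' UV'(3) k(3,4) by blast
  qed
qed

text \<open>A relation U (g + 1) = V g modulo p turns every solution of U v + V u = p into an
  admissible pair (u, v).\<close>

lemma ex_transition:
  fixes p g q :: nat
  assumes "prime p" "1 \<le> g" "Suc g < p" "q * q \<le> p" "p < Suc q * Suc q"
  shows "\<exists>u v. 1 \<le> u \<and> 2 * u \<le> p \<and> 2 * v \<le> p \<and> p dvd u * Suc g + v * g \<and>
    (u + v \<le> 2 * q \<or> (\<exists>U V. 1 \<le> U \<and> U \<le> q \<and> 1 \<le> V \<and> V \<le> q \<and> U \<noteq> V \<and>
       [U * Suc g = V * g] (mod p) \<and> (u + v) * max U V \<le> 2 * p))"
proof -
  have q2: "2 * q \<le> p"
  proof (cases "q \<le> 1")
    case False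
    hence "2 * q \<le> q * q" by simp
    thus ?thesis using assms(4) by linarith
  qed (use assms in linarith)
  obtain U V where UV: "1 \<le> U" "U \<le> q" "1 \<le> V" "V \<le> q"
    "p dvd U * Suc g + V * g \<or> (coprime U V \<and> U \<noteq> V \<and> [U * Suc g = V * g] (mod p))"
    using small_relation[OF assms] by blast
  show ?thesis
  proof (cases "p dvd U * Suc g + V * g")
    case True
    moreover have "2 * U \<le> p" "2 * V \<le> p" "U + V \<le> 2 * q" using UV q2 by linarith+
    ultimately show ?thesis using UV by blast
  next
    case False
    hence cop: "coprime U V" "U \<noteq> V" and rel: "[U * Suc g = V * g] (mod p)" using UV by auto
    \<comment> \<open>Multiplied by \<open>U\<close>, the expression becomes
      \<open>(u * V + U * v) * g = p * g\<close> modulo \<open>p\<close>; then \<open>U\<close> is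
      cancelled.\<close>
    have key: "p dvd u * Suc g + v * g" if "U * v + V * u = p" for u v
    proof -
      have "[u * (U * Suc g) + U * v * g = u * (V * g) + U * v * g] (mod p)"
        by (intro cong_add cong_mult rel) auto
      also have "u * (V * g) + U * v * g = p * g" by (simp add: that[symmetric] algebra_simps)
      finally have "p dvd U * (u * Suc g + v * g)" by (simp add: cong_def dvd_eq_mod_eq_0 algebra_simps)
      moreover have "\<not> p dvd U" using UV q2 \<open>Suc g < p\<close> by (auto dest!: dvd_imp_le)
      ultimately show ?thesis using \<open>prime p\<close> prime_dvd_mult_iff by blast
    qed
    \<comment> \<open>Here \<open>a\<close> is the larger of \<open>U\<close> and \<open>V\<close>,
      at least 2 because they differ. Both \<open>x * a \<le> q * q\<close> and \<open>a * y\<close>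
      are at most \<open>p\<close>.\<close>
    have *: "(x + y) * a \<le> 2 * p \<and> 2 * x \<le> p \<and> 2 * y \<le> p"
      if "x \<le> a" "a * y + b * x = p" "a \<le> q" "2 \<le> a" for x y a b :: nat
    proof -
      have "x * a \<le> q * q" using that by (intro mult_mono) auto
      moreover have "2 * y \<le> a * y" "a * y \<le> p" using that by simp_all
      ultimately show ?thesis using that(1,3) q2 assms(4) unfolding add_mult_distrib mult.commute[of y a]
        by (intro conjI) linarith+
    qed
    have witness: ?thesis
      if "1 \<le> u" "2 * u \<le> p" "2 * v \<le> p" "p dvd u * Suc g + v * g" "(u + v) * max U V \<le> 2 * p" for u v
      using that UV rel cop by metis
    show ?thesis
    proof (cases "V < U")
      case True
      have "U * V < q * q" using True UV by (intro mult_le_less_imp_less) auto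
      with coprime_representation[of V U p] cop UV assms(4) obtain u v
        where u: "1 \<le> u" "u \<le> U" "1 \<le> v" "U * v + V * u = p" by (auto simp: coprime_commute)
      show ?thesis
        using *[OF u(2) u(4)] key[OF u(4)] UV True u(1)
        by (intro witness[of u v]) (auto simp: max_def)
    next
      case False
      hence "U < V" using cop by simp
      have "V * U < q * q" using \<open>U < V\<close> UV by (intro mult_le_less_imp_less) auto
      with coprime_representation[of U V p] cop UV assms(4) obtain v u
        where u: "1 \<le> v" "v \<le> V" "1 \<le> u" "V * u + U * v = p" by auto
      have u': "U * v + V * u = p" using u by simp
      show ?thesis
        using *[OF u(2) u(4)] key[OF u'] UV \<open>U < V\<close> u(3)
        by (intro witness[of u v]) (auto simp: max_def add.commute)
    qed
  qed
qed

text \<open>The step to \<open>Suc q\<close> adds \<open>2 * q + 1\<close> pairs with maximum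
  \<open>Suc q\<close>, contributing at most 2.\<close>

lemma sum_inverse_max_le: "(\<Sum>U\<in>{1..q}. \<Sum>V\<in>{1..q}. 1 / real (max U V)) \<le> 2 * real q"
proof (induction q)
  case (Suc q)
  have "(\<Sum>U\<in>{1..Suc q}. \<Sum>V\<in>{1..Suc q}. 1 / real (max U V)) =
     (\<Sum>U\<in>{1..q}. (\<Sum>V\<in>{1..q}. 1 / real (max U V)) + 1 / real (Suc q)) +
     ((\<Sum>V\<in>{1..q}. 1 / real (Suc q)) + 1 / real (Suc q))"
    by (simp add: max_def)
  also have "\<dots> = (\<Sum>U\<in>{1..q}. \<Sum>V\<in>{1..q}. 1 / real (max U V)) + (2 * real q + 1) / real (Suc q)"
    by (simp add: sum.distrib add_divide_distrib)
  also have "(2 * real q + 1) / real (Suc q) \<le> 2" by (simp add: field_simps)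
  finally show ?case using Suc.IH by simp
qed simp

text \<open>Each \<open>g\<close> costs at most \<open>2 * q\<close> or
  \<open>2 * p / max U V\<close> for some relation \<open>(U, V)\<close>, and each
  \<open>(U, V)\<close> belongs to at most one \<open>g\<close>. Summation gives
  \<open>2 * p * q\<close> plus \<open>4 * p * q\<close>.\<close>

lemma ex_transitions:
  fixes p q :: nat
  assumes "prime p" "q * q \<le> p" "p < Suc q * Suc q"
  shows "\<exists>u v :: nat \<Rightarrow> nat.
    (\<forall>g. 1 \<le> g \<and> Suc g < p \<longrightarrow> 1 \<le> u g \<and> 2 * u g \<le> p \<and> 2 * v g \<le> p \<and> p dvd u g * Suc g + v g * g) \<and>
    (\<Sum>g\<in>{1..<p - 1}. real (u g + v g)) \<le> 6 * real p * real q"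
proof -
  define C where "C U V g \<longleftrightarrow> U \<noteq> V \<and> [U * Suc g = V * g] (mod p)" for U V g
  define G where "G = {1..<p - 1}"
  define Q where "Q g u v \<longleftrightarrow> 1 \<le> u \<and> 2 * u \<le> p \<and> 2 * v \<le> p \<and> p dvd u * Suc g + v * g \<and>
    (u + v \<le> 2 * q \<or> (\<exists>U V. 1 \<le> U \<and> U \<le> q \<and> 1 \<le> V \<and> V \<le> q \<and> U \<noteq> V \<and>
       [U * Suc g = V * g] (mod p) \<and> (u + v) * max U V \<le> 2 * p))" for g u v
  have "\<exists>u v. Q g u v" if "1 \<le> g \<and> Suc g < p" for g
    unfolding Q_def using that by (intro ex_transition[OF assms(1) _ _ assms(2,3)]) auto
  then obtain u v where Q: "Q g (u g) (v g)" if "1 \<le> g \<and> Suc g < p" for g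
    by metis
  note uv = Q[unfolded Q_def]
  \<comment> \<open>Charging every relation that holds at \<open>g\<close> avoids selecting one per
    \<open>g\<close>.\<close>
  define W where "W U V g = (if C U V g then 2 * real p * (1 / real (max U V)) else 0)" for U V g
  have W0: "0 \<le> W U V g" for U V g by (simp add: W_def)
  have bound: "real (u g + v g) \<le> 2 * real q + (\<Sum>U\<in>{1..q}. \<Sum>V\<in>{1..q}. W U V g)" if "g \<in> G" for g
  proof -
    have "1 \<le> g \<and> Suc g < p" using that by (auto simp: G_def)
    from uv[OF this] consider "u g + v g \<le> 2 * q"
      | U V where "1 \<le> U" "U \<le> q" "1 \<le> V" "V \<le> q" "C U V g" "(u g + v g) * max U V \<le> 2 * p"
      unfolding C_def by blast
    thus ?thesis
    proof cases
      case 1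
      moreover have "0 \<le> (\<Sum>U\<in>{1..q}. \<Sum>V\<in>{1..q}. W U V g)" by (intro sum_nonneg W0)
      ultimately show ?thesis by linarith
    next
      case 2
      have "real (u g + v g) * real (max U V) \<le> 2 * real p"
        using 2(6) by (metis of_nat_le_iff of_nat_mult of_nat_numeral)
      hence "real (u g + v g) \<le> W U V g"
        using 2 by (simp add: W_def field_simps max_def split: if_splits)
      also have "\<dots> \<le> (\<Sum>V\<in>{1..q}. W U V g)"
        using 2 W0 by (intro member_le_sum) auto
      also have "\<dots> \<le> (\<Sum>U\<in>{1..q}. \<Sum>V\<in>{1..q}. W U V g)"
        using 2 W0 by (intro member_le_sum[of U _ "\<lambda>U. \<Sum>V\<in>{1..q}. W U V g"] sum_nonneg) auto
      finally show ?thesis by simp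
    qed
  qed
  have unique: "(\<Sum>g\<in>G. W U V g) \<le> 2 * real p * (1 / real (max U V))"
    if "U \<in> {1..q}" "V \<in> {1..q}" for U V
  proof -
    have "q < p"
    proof (cases "q \<le> 1")
      case False
      hence "2 * q \<le> q * q" by simp
      thus ?thesis using assms(2) False by linarith
    qed (use prime_gt_1_nat[OF \<open>prime p\<close>] in linarith)
    have "g = h" if g: "g \<in> G" "C U V g" and h: "h \<in> G" "C U V h" for g h
    proof -
      have "int p dvd int U * (int g + 1) - int V * int g" "int p dvd int U * (int h + 1) - int V * int h"
        using g h unfolding C_def cong_int_iff[symmetric]
        by (simp_all only: cong_iff_dvd_diff of_nat_mult of_nat_Suc add.commute)
      \<comment> \<open>The relations at \<open>g\<close> and \<open>h\<close> share the constant
        term \<open>U\<close>, which cancels.\<close>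
      from dvd_diff[OF this] have "int p dvd (int U - int V) * (int g - int h)"
        by (simp add: algebra_simps)
      hence "int p dvd int U - int V \<or> int p dvd int g - int h"
        using \<open>prime p\<close> by (simp add: prime_dvd_mult_iff)
      moreover have "\<not> int p dvd int U - int V"
      proof
        assume "int p dvd int U - int V"
        hence "[U = V] (mod p)" by (simp add: cong_iff_dvd_diff flip: cong_int_iff)
        hence "U = V" using \<open>U \<in> _\<close> \<open>V \<in> _\<close> \<open>q < p\<close> by (auto simp: cong_def)
        thus False using g(2) by (simp add: C_def)
      qed
      ultimately have "[int g = int h] (mod int p)" by (simp add: cong_iff_dvd_diff)
      hence "[g = h] (mod p)" by (simp add: cong_int_iff)
      thus ?thesis using g h by (auto simp: G_def cong_def)
    qed
    hence "card {g \<in> G. C U V g} \<le> Suc 0"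
      by (subst card_le_Suc0_iff_eq) (auto simp: G_def)
    moreover have "(\<Sum>g\<in>G. W U V g) = real (card {g \<in> G. C U V g}) * (2 * real p * (1 / real (max U V)))"
      unfolding W_def by (subst sum.If_cases) (auto simp: G_def Int_def)
    ultimately show ?thesis
      using mult_right_mono[of "real (card {g \<in> G. C U V g})" 1 "2 * real p * (1 / real (max U V))"] by simp
  qed
  have "(\<Sum>g\<in>G. real (u g + v g)) \<le> (\<Sum>g\<in>G. 2 * real q + (\<Sum>U\<in>{1..q}. \<Sum>V\<in>{1..q}. W U V g))"
    by (intro sum_mono bound)
  also have "\<dots> = real (card G) * (2 * real q) + (\<Sum>U\<in>{1..q}. \<Sum>V\<in>{1..q}. \<Sum>g\<in>G. W U V g)"
    by (simp add: sum.distrib sum.swap[of _ _ G])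
  also have "\<dots> \<le> real p * (2 * real q) + (\<Sum>U\<in>{1..q}. \<Sum>V\<in>{1..q}. 2 * real p * (1 / real (max U V)))"
    using unique by (intro add_mono mult_right_mono sum_mono) (auto simp: G_def)
  also have "\<dots> \<le> real p * (2 * real q) + 2 * real p * (2 * real q)"
    unfolding sum_distrib_left[symmetric] by (intro add_mono mult_left_mono sum_inverse_max_le) auto
  finally have "(\<Sum>g\<in>G. real (u g + v g)) \<le> 6 * real p * real q" by simp
  moreover have "\<forall>g. 1 \<le> g \<and> Suc g < p \<longrightarrow>
      1 \<le> u g \<and> 2 * u g \<le> p \<and> 2 * v g \<le> p \<and> p dvd u g * Suc g + v g * g"
    using uv by blast
  ultimately show ?thesis unfolding G_def by blast
qed

section \<open>Lower bound\<close>

text \<open>In phase \<open>h\<close> the tested part is congruent to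
  \<open>(u (h - 1) + i) * h\<close> at step \<open>i\<close>. Starting \<open>u (h - 1)\<close>
  steps late and stopping \<open>v h\<close> early keeps the multiplier strictly between 0 and
  \<open>p\<close>, and admissibility of the pair at \<open>h\<close> fits the next phase to this
  pattern.\<close>

lemma ex_row_counts:
  fixes p q :: nat
  assumes "prime p" "q * q \<le> p" "p < Suc q * Suc q"
  shows "\<exists>(K :: nat) (g :: nat \<Rightarrow> nat) (r :: nat \<Rightarrow> nat).
    mono g \<and> (\<forall>k<K. 1 \<le> g k \<and> g k < p \<and> \<not> p dvd (\<Sum>j<k. g j) + 1) \<and>
    (\<forall>h<p. r h \<le> p) \<and> (\<Sum>h\<in>{1..<p}. real p - real (r h)) \<le> 6 * real p * real q + real p + 1 \<and>
    real (\<Sum>k<K. (p - g k) * (\<Sum>j<k. g j)) = phase_weight p (\<lambda>h. real (r h)) (-1)"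
proof -
  have p2: "2 \<le> p" using \<open>prime p\<close> by (rule prime_ge_2_nat)
  obtain u0 v where uv: "\<And>h. 1 \<le> h \<Longrightarrow> Suc h < p \<Longrightarrow>
      1 \<le> u0 h \<and> 2 * u0 h \<le> p \<and> 2 * v h \<le> p \<and> p dvd u0 h * Suc h + v h * h"
    and total: "(\<Sum>h\<in>{1..<p - 1}. real (u0 h + v h)) \<le> 6 * real p * real q"
    using ex_transitions[OF assms] by blast
  \<comment> \<open>The value 1 at 0 reflects that the first part is 1, from the single gap on
    runner 0.\<close>
  define u where "u h = (if h = 0 then 1 else u0 h)" for h
  define r where "r h = (if 1 \<le> h \<and> Suc h < p then p - u (h - 1) - v h else 0)" for h
  define s where "s h = (\<Sum>i<h. r i)" for h
  \<comment> \<open>The number of phases completed by row \<open>k\<close> is the index of the phase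
    containing it.\<close>
  define g where "g k = card {h. h < p \<and> s (Suc h) \<le> k}" for k
  have u1: "1 \<le> u h \<and> 2 * u h \<le> p" if "Suc h < p" for h
    using uv[of h] that p2 by (auto simp: u_def)
  have s_mono: "mono s" unfolding s_def mono_def by (auto intro: sum_mono2)
  have s0: "s 0 = 0" by (simp add: s_def)
  have s_Suc: "s (Suc h) = s h + r h" for h by (simp add: s_def)
  have g_mono: "mono g" unfolding g_def mono_def by (auto intro!: card_mono)
  have phase: "g k = h" if "h < p" "s h \<le> k" "k < s (Suc h)" for h k
  proof -
    have "s (Suc i) \<le> k \<longleftrightarrow> i < h" for i
      using that monoD[OF s_mono, of "Suc i" h] monoD[OF s_mono, of "Suc h" "Suc i"] by (cases "i < h") auto
    hence "{h. h < p \<and> s (Suc h) \<le> k} = {..<h}"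
      using that(1) by (simp only: lessThan_def) (auto intro: less_trans)
    thus ?thesis by (simp add: g_def)
  qed
  have ex_phase: "\<exists>h<n. s h \<le> k \<and> k < s (Suc h)" if "k < s n" for k n
    using that
  proof (induction n)
    case (Suc n)
    thus ?case by (cases "k < s n") (auto intro: less_SucI)
  qed (simp add: s0)
  have prefix: "(\<Sum>j<s h + i. g j) = (\<Sum>j<s h. g j) + i * h" if "h < p" "i \<le> r h" for h i
    using that phase by (intro sum_phase_prefix) (auto simp: s_Suc)
  have start: "[(\<Sum>j<s (Suc h). g j) + 1 = u h * Suc h] (mod p)" if "Suc h < p" for h
    using that
  proof (induction h)
    case 0
    have "s (Suc 0) = 0" by (simp add: s_def r_def)
    thus ?case by (simp add: u_def)
  next
    case (Suc h)
    let ?h = "Suc h"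
    have h: "1 \<le> ?h" "Suc ?h < p" "?h < p" using Suc.prems by auto
    have le: "u h + v ?h \<le> p" using u1[of h] uv[OF h(1,2)] h by auto
    have r: "r ?h = p - u h - v ?h" using h by (simp add: r_def)
    have "(\<Sum>j<s (Suc ?h). g j) + 1 + v ?h * ?h = ((\<Sum>j<s ?h. g j) + 1) + r ?h * ?h + v ?h * ?h"
      using prefix[OF h(3), of "r ?h"] by (simp add: s_Suc)
    also have "[\<dots> = u h * ?h + r ?h * ?h + v ?h * ?h] (mod p)"
      using Suc.IH h by (intro cong_add) auto
    also have "u h * ?h + r ?h * ?h + v ?h * ?h = p * ?h"
      unfolding add_mult_distrib[symmetric] r using le by simp
    \<comment> \<open>Both sides are 0 modulo \<open>p\<close>, the right one by admissibility;
      cancelling \<open>v ?h * ?h\<close> then leaves the claim.\<close>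
    also have "[p * ?h = u ?h * Suc ?h + v ?h * ?h] (mod p)"
      using uv[OF h(1,2)] by (simp add: u_def cong_def dvd_eq_mod_eq_0)
    finally show ?case by (simp only: cong_add_rcancel_nat)
  qed
  have row: "1 \<le> g k \<and> g k < p \<and> \<not> p dvd (\<Sum>j<k. g j) + 1" if k: "k < s p" for k
  proof -
    obtain h where h: "h < p" "s h \<le> k" "k < s (Suc h)" using ex_phase[OF k] by blast
    have gk: "g k = h" by (rule phase) fact+
    have "r h \<noteq> 0" using h by (auto simp: s_Suc)
    hence h': "1 \<le> h" "Suc h < p" "r h = p - u (h - 1) - v h"
      by (auto simp: r_def split: if_splits)
    define i where "i = k - s h"
    have i: "i < r h" "k = s h + i" using h by (auto simp: i_def s_Suc)
    have "[(\<Sum>j<k. g j) + 1 = ((\<Sum>j<s h. g j) + 1) + i * h] (mod p)"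
      using prefix[of h i] i h by simp
    also have "[((\<Sum>j<s h. g j) + 1) + i * h = u (h - 1) * h + i * h] (mod p)"
      using start[of "h - 1"] h' by (intro cong_add) auto
    also have "u (h - 1) * h + i * h = (u (h - 1) + i) * h" by (simp add: add_mult_distrib)
    finally have "p dvd (\<Sum>j<k. g j) + 1 \<longleftrightarrow> p dvd (u (h - 1) + i) * h"
      by (rule cong_dvd_iff[OF cong_sym, symmetric])
    moreover have "0 < u (h - 1) + i" "u (h - 1) + i < p"
      using u1[of "h - 1"] i h' by auto
    hence "\<not> p dvd (u (h - 1) + i) * h"
      using \<open>prime p\<close> h' by (metis Suc_lessD nat_dvd_not_less prime_dvd_mult_iff less_le_trans zero_less_one)
    ultimately show ?thesis using gk h h' by simp
  qed
  have "(\<Sum>h\<in>{1..<p}. real p - real (r h)) \<le> (\<Sum>h\<in>{1..<p - 1}. real p - real (r h)) + real p"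
  proof -
    \<comment> \<open>The phase \<open>p - 1\<close> is left empty and contributes the extra deficit
      \<open>p\<close>.\<close>
    have "{1..<p} = insert (p - 1) {1..<p - 1} \<or> p = 1" using p2 by auto
    thus ?thesis using p2 by (auto simp: r_def)
  qed
  also have "(\<Sum>h\<in>{1..<p - 1}. real p - real (r h)) \<le> (\<Sum>h\<in>{1..<p - 1}. real (u (h - 1)) + real (v h))"
    by (intro sum_mono) (auto simp: r_def)
  also have "\<dots> = (\<Sum>h\<in>{1..<p - 1}. real (u (h - 1))) + (\<Sum>h\<in>{1..<p - 1}. real (v h))"
    by (simp add: sum.distrib)
  also have "(\<Sum>h\<in>{1..<p - 1}. real (u (h - 1))) = (\<Sum>h<p - 2. real (u h))"
    using p2 by (intro sum.reindex_bij_witness[of _ Suc "\<lambda>h. h - 1"]) auto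
  also have "\<dots> \<le> (\<Sum>h\<in>insert 0 {1..<p - 1}. real (u h))"
    by (intro sum_mono2) auto
  also have "\<dots> = 1 + (\<Sum>h\<in>{1..<p - 1}. real (u0 h))" by (simp add: u_def)
  finally have "(\<Sum>h\<in>{1..<p}. real p - real (r h)) \<le>
      1 + (\<Sum>h\<in>{1..<p - 1}. real (u0 h + v h)) + real p" by (simp add: sum.distrib)
  with total have deficit: "(\<Sum>h\<in>{1..<p}. real p - real (r h)) \<le> 6 * real p * real q + real p + 1" by simp
  have "real (\<Sum>k<s p. (p - g k) * (\<Sum>j<k. g j)) =
      (\<Sum>k<s p. real (p - g k) * (real (\<Sum>j<k. g j) + 0 * real (g k)))" by simp
  also have "\<dots> = phase_weight p (\<lambda>h. real (s (Suc h) - s h)) (2 * 0 - 1)"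
    by (rule phase_weight_eq) (use s0 s_mono phase in auto)
  also have "\<dots> = phase_weight p (\<lambda>h. real (r h)) (-1)" by (simp add: s_Suc)
  finally have "real (\<Sum>k<s p. (p - g k) * (\<Sum>j<k. g j)) = phase_weight p (\<lambda>h. real (r h)) (-1)" .
  moreover have "\<forall>h<p. r h \<le> p" by (auto simp: r_def)
  ultimately show ?thesis using g_mono row deficit by blast
qed

text \<open>As \<open>h * (p - h)\<close> is at most \<open>P ^ 2 / 4\<close>, the loss has leading
  term \<open>3 / 4 * P ^ 5 * Q\<close>; the remaining quarter absorbs the terms of order
  \<open>P ^ 5\<close> and below.\<close>

lemma phase_weight_greater:
  fixes r :: "nat \<Rightarrow> nat"
  assumes "p > 10 ^ 6" "real q \<le> sqrt (real p)"
    and r: "\<And>h. h < p \<Longrightarrow> r h \<le> p"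
    and deficit: "(\<Sum>h\<in>{1..<p}. real p - real (r h)) \<le> 6 * real p * real q + real p + 1"
  shows "phase_weight p (\<lambda>h. real (r h)) (-1) > 1 / 24 * real p ^ 6 - real p ^ 5 * sqrt (real p)"
proof -
  define P where "P = real p"
  define Q where "Q = sqrt (real p)"
  have P: "P \<ge> 1000000" using assms(1) by (simp add: P_def)
  have Q: "Q \<ge> 1000"
    unfolding Q_def using assms(1) by (intro real_le_rsqrt) simp
  have "(\<Sum>h<p. real h * real (p - h) * (real p - real (r h))) =
      (\<Sum>h\<in>{1..<p}. real h * real (p - h) * (real p - real (r h)))"
    by (intro sum.mono_neutral_right) auto
  also have "\<dots> \<le> (\<Sum>h\<in>{1..<p}. P ^ 2 / 4 * (real p - real (r h)))"
  proof (intro sum_mono mult_right_mono)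
    fix h assume h: "h \<in> {1..<p}"
    have "0 \<le> (P - 2 * real h) ^ 2" by simp
    also have "\<dots> = P ^ 2 - 4 * (real h * real (p - h))"
      using h by (simp add: P_def of_nat_diff power2_eq_square algebra_simps)
    finally show "real h * real (p - h) \<le> P ^ 2 / 4" by simp
  qed (use r in auto)
  also have "\<dots> \<le> P ^ 2 / 4 * (6 * P * Q + P + 1)"
    unfolding sum_distrib_left[symmetric] P_def
    by (intro mult_left_mono order_trans[OF deficit]) (use assms(2) in \<open>auto simp: Q_def mult_left_mono\<close>)
  finally have L: "(\<Sum>h<p. real h * real (p - h) * (real p - real (r h))) \<le> P ^ 2 / 4 * (6 * P * Q + P + 1)" .
  have "1 / 24 * P ^ 6 - P ^ 5 * Q <
      P ^ 2 * ((P + 1) * P * (P - 1) * (P - 2) / 24) - P * P / 2 * (P ^ 2 / 4 * (6 * P * Q + P + 1))"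
  proof -
    have main: "P ^ 2 * ((P + 1) * P * (P - 1) * (P - 2) / 24) =
        1 / 24 * P ^ 6 - 1 / 12 * P ^ 5 - 1 / 24 * P ^ 4 + 1 / 12 * P ^ 3"
      by (simp add: field_simps power_numeral_reduce)
    have loss: "P * P / 2 * (P ^ 2 / 4 * (6 * P * Q + P + 1)) =
        3 / 4 * (P ^ 5 * Q) + 1 / 8 * P ^ 5 + 1 / 8 * P ^ 4"
      by (simp add: field_simps power_numeral_reduce)
    have "1000000 * P ^ 4 \<le> P ^ 5"
      using P by (simp add: power_numeral_reduce mult_right_mono)
    moreover have "1000 * P ^ 5 \<le> P ^ 5 * Q" using P Q by simp
    moreover have "0 < P ^ 5" "0 \<le> P ^ 3" "0 \<le> P ^ 4" using P by auto
    ultimately show ?thesis unfolding main loss by linarith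
  qed
  also have "\<dots> \<le> P ^ 2 * ((P + 1) * P * (P - 1) * (P - 2) / 24)
      - P * (P - 2) / 2 * (\<Sum>h<p. real h * real (p - h) * (real p - real (r h)))"
    using L P r by (intro diff_left_mono mult_mono divide_right_mono sum_nonneg mult_nonneg_nonneg) auto
  also have "\<dots> \<le> phase_weight p (\<lambda>h. real (r h)) (-1)"
    unfolding P_def using r by (rule phase_weight_lower)
  finally show ?thesis by (simp only: P_def Q_def)
qed

text \<open>The beads of row k occupy the runners 1, ..., p - g k.\<close>

lemma partition_of_row_counts:
  fixes g :: "nat \<Rightarrow> nat"
  assumes "mono g" and g: "\<And>k. k < K \<Longrightarrow> 1 \<le> g k \<and> g k < p \<and> \<not> p dvd (\<Sum>j<k. g j) + 1"
  shows "\<exists>\<mu>. is_partition \<mu> \<and> is_core p \<mu> \<and> is_prime_to p \<mu> \<and>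
    (\<Sum>k<K. (p - g k) * (\<Sum>j<k. g j)) \<le> partition_size \<mu>"
proof (cases "K = 0")
  case True
  thus ?thesis
    by (intro exI[of _ "[]"])
       (auto simp: is_partition_def is_core_def is_prime_to_def young_diagram_def partition_size_def)
next
  case False
  hence p: "p > 0" using g[of 0] by auto
  define X where "X = {b. b div p < K \<and> 1 \<le> b mod p \<and> b mod p \<le> p - g (b div p)}"
  have "X \<subseteq> {..<K * p}" by (auto simp: X_def div_less_iff_less_mult p)
  hence fin: "finite X" using finite_subset by blast
  have X0: "0 \<notin> X" by (simp add: X_def)
  have mem: "k * p + i \<in> X \<longleftrightarrow> k < K \<and> 1 \<le> i \<and> i \<le> p - g k" if "i < p" for k i
    using that by (simp add: X_def)
  \<comment> \<open>A bead has only runner 0 empty to its left in its own row, so all beads of row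
    \<open>k\<close> give the same part.\<close>
  have gaps: "row_gaps p X k = insert 0 {p - g k<..<p}" if "k < K" for k
    using that p mem[of _ k] by (auto simp: row_gaps_def)
  have card_gaps: "card (row_gaps p X k) = g k" if "k < K" for k
    using g[OF that] by (simp add: gaps[OF that])
  have beads: "gaps_below X (k * p + i) = (\<Sum>j<k. g j) + 1" if "k < K" "1 \<le> i" "i \<le> p - g k" for k i
  proof -
    have "i \<le> p" "row_gaps p X k \<inter> {..<i} = {0}" using that by (auto simp: gaps)
    moreover have "(\<Sum>j<k. card (row_gaps p X j)) = (\<Sum>j<k. g j)"
      using that card_gaps by (intro sum.cong) auto
    ultimately show ?thesis by (simp add: gaps_below_eq)
  qed
  have bead: "gaps_below X b = (\<Sum>j<b div p. g j) + 1 \<and> b div p < K" if "b \<in> X" for b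
    using that beads[of "b div p" "b mod p"] by (simp add: X_def)
  have closed: "b - p \<in> X" if "b \<in> X" "p \<le> b" for b
  proof -
    have "(b - p) div p = b div p - 1" "(b - p) mod p = b mod p"
      using that p le_div_geq[of p b] le_mod_geq[of p b] by simp_all
    \<comment> \<open>The previous row has no more gaps, so the runner of \<open>b\<close> is
      occupied there as well.\<close>
    moreover have "g (b div p - 1) \<le> g (b div p)" using \<open>mono g\<close> by (simp add: mono_def)
    ultimately show ?thesis using that(1) by (auto simp: X_def)
  qed
  have "(\<Sum>k<K. (p - g k) * (\<Sum>j<k. g j)) = (\<Sum>k<K. \<Sum>i\<in>{..<p} - row_gaps p X k. (\<Sum>j<k. g j))"
    by (intro sum.cong) (auto simp: card_row_beads card_gaps)
  also have "\<dots> \<le> (\<Sum>k<K. \<Sum>i\<in>{..<p} - row_gaps p X k. gaps_below X (k * p + i))"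
  proof (intro sum_mono)
    fix k i assume "k \<in> {..<K}" "i \<in> {..<p} - row_gaps p X k"
    hence "k < K" "1 \<le> i" "i \<le> p - g k" by (auto simp: gaps)
    thus "(\<Sum>j<k. g j) \<le> gaps_below X (k * p + i)" by (simp add: beads)
  qed
  also have "\<dots> = (\<Sum>b\<in>X. gaps_below X b)"
    using fin p \<open>X \<subseteq> {..<K * p}\<close> by (intro sum_over_rows[symmetric]) auto
  finally have "(\<Sum>k<K. (p - g k) * (\<Sum>j<k. g j)) \<le> partition_size (beta_partition X)"
    by (simp add: partition_size_beta fin)
  moreover have "is_prime_to p (beta_partition X)"
    using bead g by (auto simp: is_prime_to_def set_beta_partition fin)
  moreover have "is_core p (beta_partition X)"
    using closed is_core_beta_iff_closed[OF fin p] by blast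
  ultimately show ?thesis using is_partition_beta[OF fin X0] by blast
qed

section \<open>Combination into bounds for partitions\<close>

lemma core_prime_to_size_less:
  assumes p: "prime p" "p > 10 ^ 6"
    and \<mu>: "is_partition \<mu>" "is_core p \<mu>" "is_prime_to p \<mu>"
  shows "real (partition_size \<mu>) < 1 / 24 * real p ^ 6 - 1 / 200 * real p ^ 5 * sqrt (real p)"
proof -
  have p0: "p > 0" using p by simp
  obtain X where X: "finite X" "0 \<notin> X" "\<mu> = beta_partition X"
    using ex_beta_partition[OF \<mu>(1)] by blast
  obtain K and g c :: "nat \<Rightarrow> nat" where
    row: "\<And>k. k < K \<Longrightarrow> 1 \<le> g k \<and> g k < p \<and> \<not> p dvd (\<Sum>j<k. g j) + c k" and
    mono: "\<And>k k'. k \<le> k' \<Longrightarrow> c k \<le> c k' \<and> g k + c k' \<le> g k' + c k" and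
    le: "partition_size \<mu> \<le> (\<Sum>k<K. (p - g k) * (\<Sum>j\<le>k. g j))"
  \<comment> \<open>A largest bead exists only for nonempty \<open>X\<close>; the empty partition is
    given zero rows.\<close>
  proof (cases "X = {}")
    case True
    thus ?thesis using that[of 0 "\<lambda>_. 0" "\<lambda>_. 0"] X by (simp add: partition_size_beta)
  next
    case False
    have "\<forall>b\<in>X. p \<le> b \<longrightarrow> b - p \<in> X"
      using \<mu>(2) is_core_beta_iff_closed[OF X(1) p0] X(3) by simp
    moreover have "\<forall>b\<in>X. \<not> p dvd gaps_below X b"
      using \<mu>(3) by (simp add: X(1,3) is_prime_to_def set_beta_partition)
    ultimately obtain K and g c :: "nat \<Rightarrow> nat" where
      "\<forall>k<K. 1 \<le> g k \<and> g k < p \<and> \<not> p dvd (\<Sum>j<k. g j) + c k"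
      "\<forall>k k'. k \<le> k' \<longrightarrow> c k \<le> c k' \<and> g k + c k' \<le> g k' + c k"
      "(\<Sum>b\<in>X. gaps_below X b) \<le> (\<Sum>k<K. (p - g k) * (\<Sum>j\<le>k. g j))"
      using core_prime_to_row_data[OF X(1,2) False p0] by blast
    thus ?thesis using that[of K g c] X(1,3) by (simp add: partition_size_beta)
  qed
  obtain r :: "nat \<Rightarrow> nat" where r: "\<And>h. h < p \<Longrightarrow> r h < p"
    "\<And>h. 1 \<le> h \<Longrightarrow> Suc h < p \<Longrightarrow>
      \<exists>e t. 1 \<le> e \<and> e + r h + r (Suc h) < 2 * p \<and> t \<le> e \<and> p dvd e * h + t"
    "real (\<Sum>k<K. (p - g k) * (\<Sum>j\<le>k. g j)) = phase_weight p (\<lambda>h. real (r h)) 1"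
    using row_data_phases[OF p(1) row mono] by blast
  have "real (partition_size \<mu>) \<le> real (\<Sum>k<K. (p - g k) * (\<Sum>j\<le>k. g j))"
    using le by (simp only: of_nat_le_iff)
  also have "\<dots> < 1 / 24 * real p ^ 6 - 1 / 200 * real p ^ 5 * sqrt (real p)"
    unfolding r(3) by (rule phase_weight_less) (use p r(1,2) in auto)
  finally show ?thesis .
qed

lemma ex_large_core_prime_to:
  assumes p: "prime p" "p > 10 ^ 6"
  shows "\<exists>\<mu>. is_partition \<mu> \<and> is_core p \<mu> \<and> is_prime_to p \<mu> \<and>
    1 / 24 * real p ^ 6 - real p ^ 5 * sqrt (real p) < real (partition_size \<mu>)"
proof -
  \<comment> \<open>The integer part of the square root keeps relations short and still leaves
    enough pairs for the pigeonhole argument.\<close>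
  define q where "q = nat \<lfloor>sqrt (real p)\<rfloor>"
  have q: "real q \<le> sqrt (real p)" "sqrt (real p) < real (Suc q)"
    unfolding q_def using real_sqrt_ge_zero[of "real p"] by linarith+
  have "real q * real q \<le> sqrt (real p) * sqrt (real p)" using q by (intro mult_mono) auto
  hence 1: "q * q \<le> p" by (simp flip: of_nat_mult)
  have "sqrt (real p) * sqrt (real p) < real (Suc q) * real (Suc q)"
    using q by (intro mult_strict_mono) auto
  hence 2: "p < Suc q * Suc q" by (simp flip: of_nat_mult del: of_nat_Suc)
  obtain K :: nat and g r :: "nat \<Rightarrow> nat" where *: "mono g"
    "\<And>k. k < K \<Longrightarrow> 1 \<le> g k \<and> g k < p \<and> \<not> p dvd (\<Sum>j<k. g j) + 1"
    "\<And>h. h < p \<Longrightarrow> r h \<le> p"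
    "(\<Sum>h\<in>{1..<p}. real p - real (r h)) \<le> 6 * real p * real q + real p + 1"
    "real (\<Sum>k<K. (p - g k) * (\<Sum>j<k. g j)) = phase_weight p (\<lambda>h. real (r h)) (-1)"
    using ex_row_counts[OF p(1) 1 2] by blast
  obtain \<mu> where \<mu>: "is_partition \<mu>" "is_core p \<mu>" "is_prime_to p \<mu>"
    "(\<Sum>k<K. (p - g k) * (\<Sum>j<k. g j)) \<le> partition_size \<mu>"
    using partition_of_row_counts[OF *(1,2)] by blast
  have "1 / 24 * real p ^ 6 - real p ^ 5 * sqrt (real p) < phase_weight p (\<lambda>h. real (r h)) (-1)"
    using phase_weight_greater[OF p(2) q(1) *(3,4)] by simp
  also have "\<dots> \<le> real (partition_size \<mu>)"
    using \<mu>(4) unfolding *(5)[symmetric] by (simp only: of_nat_le_iff)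
  finally show ?thesis using \<mu> by blast
qed

theorem theorem1p1:
  fixes p :: nat and \<Lambda> :: "nat list"
  assumes "prime p" and "p > 10 ^ 6" and "is_maximal_core_prime_to p \<Lambda>"
  shows "1 / 24 * real p ^ 6 - real p ^ 5 * sqrt (real p) < real (partition_size \<Lambda>)
    \<and> real (partition_size \<Lambda>) < 1 / 24 * real p ^ 6 - 1 / 200 * real p ^ 5 * sqrt (real p)"
proof -
  have \<Lambda>: "is_partition \<Lambda>" "is_core p \<Lambda>" "is_prime_to p \<Lambda>"
    and max: "\<And>\<mu>. is_partition \<mu> \<Longrightarrow> is_core p \<mu> \<Longrightarrow> is_prime_to p \<mu> \<Longrightarrow>
      partition_size \<mu> \<le> partition_size \<Lambda>"
    using assms(3) by (auto simp: is_maximal_core_prime_to_def is_arg_max_def not_less)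
  obtain \<mu> where \<mu>: "is_partition \<mu>" "is_core p \<mu>" "is_prime_to p \<mu>"
    "1 / 24 * real p ^ 6 - real p ^ 5 * sqrt (real p) < real (partition_size \<mu>)"
    using ex_large_core_prime_to[OF assms(1,2)] by blast
  \<comment> \<open>Maximality carries the lower bound from the constructed partition over to
    \<open>\<Lambda>\<close>.\<close>
  have "real (partition_size \<mu>) \<le> real (partition_size \<Lambda>)"
    using max[OF \<mu>(1-3)] by (simp only: of_nat_le_iff)
  with \<mu>(4) core_prime_to_size_less[OF assms(1,2) \<Lambda>] show ?thesis by linarith
qed

end
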